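(* Let $n\ge 1$ and let $\Omega\subset\mathbb{R}^n$ be a non-empty open set for which there are $j\in\{1,\dots,n\}$ and $c>0$ with $\|\partial^{e_j}f\|_2\ge c\,\|f\|_2$ for all $f\in W^1_{0,\mathbb{C}}(\Omega)$. Let $\bar p\in L^\infty(\Omega)$ be real-valued. Then the densely-defined linear operator $\hat A:W^1_{0,\mathbb{C}}(\Omega)\times D(\nabla_0^* )\to L^2_{\mathbb{C}}(\Omega)\times(L^2_{\mathbb{C}}(\Omega))^n$ in $L^2_{\mathbb{C}}(\Omega)\times(L^2_{\mathbb{C}}(\Omega))^n$ defined by $$\hat A(u,q):=(\nabla_0^*q,\ \nabla_wu-\bar p\,q)$$ is self-adjoint.
   Context: $L^2_{\mathbb{C}}(\Omega)$ is the Hilbert space of complex-valued square-integrable functions (Lebesgue measure) with $\langle f|g\rangle_2=\int_\Omega f^*g$ and norm $\|\cdot\|_2$; $(L^2_{\mathbb{C}}(\Omega))^k$ carries $\langle f|g\rangle_{2,k}=\sum_{j=1}^k\langle f_j|g_j\rangle_2$; $L^2_{\mathbb{C}}(\Omega)\times(L^2_{\mathbb{C}}(\Omega))^n$ carries the product Hilbert space structure. $\partial^{e_k}$ is the $k$-th weak partial derivative in $L^2_{\mathbb{C}}(\Omega)$, i.e. $-1$ times the adjoint of $C_0^\infty(\Omega,\mathbb{C})\to L^2_{\mathbb{C}}(\Omega)$, $f\mapsto\partial f/\partial x_k$. $W^1_{\mathbb{C}}(\Omega)$ is the Sobolev space $\bigcap_{k=1}^n D(\partial^{e_k})$ with norm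 given by $\|f\|_2^2+\sum_k\|\partial^{e_k}f\|_2^2$ (squared), and $W^1_{0,\mathbb{C}}(\Omega)$ is the closure of $C_0^\infty(\Omega,\mathbb{C})$ in it. $\nabla_0:C_0^\infty(\Omega,\mathbb{C})\to(L^2_{\mathbb{C}}(\Omega))^n$ is the classical gradient, viewed as a densely-defined operator in $L^2_{\mathbb{C}}(\Omega)$; $\nabla_0^*$ is its Hilbert space adjoint, with domain $D(\nabla_0^* )\subset(L^2_{\mathbb{C}}(\Omega))^n$ and values in $L^2_{\mathbb{C}}(\Omega)$; $\nabla_w f=(\partial^{e_1}f,\dots,\partial^{e_n}f)$ for $f\in W^1_{\mathbb{C}}(\Omega)$. *)

theory Defs
  imports "HOL-Analysis.Analysis"
begin

section \<open>Complex inner product spaces\<close>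

text \<open>
  The inner product is antilinear in its first argument. The real structure (norm, topology) is the
  one of the underlying \<^class>\<open>real_inner\<close> space, whose inner product is the real part.
\<close>

class complex_inner = real_inner +
  fixes scaleC :: "complex \<Rightarrow> 'a \<Rightarrow> 'a" (infixr "*\<^sub>C" 75)
    and cinner :: "'a \<Rightarrow> 'a \<Rightarrow> complex"
  assumes scaleC_of_real: "complex_of_real r *\<^sub>C x = r *\<^sub>R x"
    and scaleC_add_right: "a *\<^sub>C (x + y) = a *\<^sub>C x + a *\<^sub>C y"
    and scaleC_add_left: "(a + b) *\<^sub>C x = a *\<^sub>C x + b *\<^sub>C x"
    and scaleC_scaleC: "a *\<^sub>C (b *\<^sub>C x) = (a * b) *\<^sub>C x"
    and cinner_commute: "cinner x y = cnj (cinner y x)"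
    and cinner_add_left: "cinner (x + y) z = cinner x z + cinner y z"
    and cinner_scaleC_left: "cinner (a *\<^sub>C x) y = cnj a * cinner x y"
    and inner_eq_Re_cinner: "inner x y = Re (cinner x y)"

instantiation prod :: (complex_inner, complex_inner) complex_inner
begin

definition "a *\<^sub>C x = (a *\<^sub>C fst x, a *\<^sub>C snd x)"
definition "cinner x y = cinner (fst x) (fst y) + cinner (snd x) (snd y)"

instance
proof
  fix a b :: complex and r :: real and x y z :: "'a \<times> 'b"
  show "complex_of_real r *\<^sub>C x = r *\<^sub>R x"
    by (simp add: scaleC_prod_def scaleC_of_real prod_eq_iff)
  show "a *\<^sub>C (x + y) = a *\<^sub>C x + a *\<^sub>C y"
    by (simp add: scaleC_prod_def scaleC_add_right)
  show "(a + b) *\<^sub>C x = a *\<^sub>C x + b *\<^sub>C x"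
    by (simp add: scaleC_prod_def scaleC_add_left)
  show "a *\<^sub>C (b *\<^sub>C x) = (a * b) *\<^sub>C x"
    by (simp add: scaleC_prod_def scaleC_scaleC)
  show "cinner x y = cnj (cinner y x)"
    using cinner_commute[of "fst x" "fst y"] cinner_commute[of "snd x" "snd y"]
    by (simp add: cinner_prod_def)
  show "cinner (x + y) z = cinner x z + cinner y z"
    by (simp add: cinner_prod_def cinner_add_left)
  show "cinner (a *\<^sub>C x) y = cnj a * cinner x y"
    by (simp add: cinner_prod_def scaleC_prod_def cinner_scaleC_left distrib_left)
  show "inner x y = Re (cinner x y)"
    by (simp add: cinner_prod_def inner_prod_def inner_eq_Re_cinner)
qed

end

instantiation vec :: (complex_inner, finite) complex_inner
begin

definition "a *\<^sub>C x = (\<chi> i. a *\<^sub>C (x $ i))"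
definition "cinner x y = (\<Sum>i\<in>UNIV. cinner (x $ i) (y $ i))"

instance
proof
  fix a b :: complex and r :: real and x y z :: "'a ^ 'b"
  show "complex_of_real r *\<^sub>C x = r *\<^sub>R x"
    by (simp add: scaleC_vec_def scaleC_of_real vec_eq_iff)
  show "a *\<^sub>C (x + y) = a *\<^sub>C x + a *\<^sub>C y"
    by (simp add: scaleC_vec_def scaleC_add_right vec_eq_iff)
  show "(a + b) *\<^sub>C x = a *\<^sub>C x + b *\<^sub>C x"
    by (simp add: scaleC_vec_def scaleC_add_left vec_eq_iff)
  show "a *\<^sub>C (b *\<^sub>C x) = (a * b) *\<^sub>C x"
    by (simp add: scaleC_vec_def scaleC_scaleC vec_eq_iff)
  show "cinner x y = cnj (cinner y x)"
    unfolding cinner_vec_def cnj_sum by (rule sum.cong[OF refl]) (rule cinner_commute)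
  show "cinner (x + y) z = cinner x z + cinner y z"
    by (simp add: cinner_vec_def cinner_add_left sum.distrib)
  show "cinner (a *\<^sub>C x) y = cnj a * cinner x y"
    by (simp add: cinner_vec_def scaleC_vec_def cinner_scaleC_left sum_distrib_left)
  show "inner x y = Re (cinner x y)"
    by (simp add: cinner_vec_def inner_vec_def inner_eq_Re_cinner)
qed

end


section \<open>Square-integrable functions\<close>

definition square_integrable :: "('a::euclidean_space \<Rightarrow> complex) \<Rightarrow> bool" where
  "square_integrable f \<longleftrightarrow>
     f \<in> borel_measurable lebesgue \<and> integrable lebesgue (\<lambda>x. (cmod (f x))\<^sup>2)"

lemma square_integrable_zero: "square_integrable (\<lambda>x. 0)"
  by (simp add: square_integrable_def)

lemma square_integrable_scale:
  assumes "square_integrable f"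
  shows "square_integrable (\<lambda>x. a * f x)"
  using assms by (auto simp: square_integrable_def norm_mult power_mult_distrib)

lemma square_integrable_add:
  assumes "square_integrable f" "square_integrable g"
  shows "square_integrable (\<lambda>x. f x + g x)"
proof -
  have [measurable]: "f \<in> borel_measurable lebesgue" "g \<in> borel_measurable lebesgue"
    using assms by (auto simp: square_integrable_def)
  have bound: "(cmod (f x + g x))\<^sup>2 \<le> 2 * (cmod (f x))\<^sup>2 + 2 * (cmod (g x))\<^sup>2" for x
  proof -
    have "(cmod (f x + g x))\<^sup>2 \<le> (cmod (f x) + cmod (g x))\<^sup>2"
      by (simp add: norm_triangle_ineq power_mono)
    also have "\<dots> \<le> 2 * (cmod (f x))\<^sup>2 + 2 * (cmod (g x))\<^sup>2"
      using zero_le_power2[of "cmod (f x) - cmod (g x)"]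
      by (simp add: power2_sum power2_diff)
    finally show ?thesis .
  qed
  have "integrable lebesgue (\<lambda>x. 2 * (cmod (f x))\<^sup>2 + 2 * (cmod (g x))\<^sup>2)"
    using assms by (simp add: square_integrable_def)
  then have "integrable lebesgue (\<lambda>x. (cmod (f x + g x))\<^sup>2)"
    by (rule Bochner_Integration.integrable_bound) (use bound in auto)
  then show ?thesis
    by (simp add: square_integrable_def)
qed

lemma square_integrable_uminus:
  "square_integrable f \<Longrightarrow> square_integrable (\<lambda>x. - f x)"
  using square_integrable_scale[of f "-1"] by simp

lemma square_integrable_diff:
  "square_integrable f \<Longrightarrow> square_integrable g \<Longrightarrow> square_integrable (\<lambda>x. f x - g x)"
  using square_integrable_add[of f "\<lambda>x. - g x"] square_integrable_uminus[of g] by simp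

lemma square_integrable_product:
  assumes "square_integrable f" "square_integrable g"
  shows "integrable lebesgue (\<lambda>x. cnj (f x) * g x)"
proof -
  have [measurable]: "f \<in> borel_measurable lebesgue" "g \<in> borel_measurable lebesgue"
    using assms by (auto simp: square_integrable_def)
  have cnj_f [measurable]: "(\<lambda>x. cnj (f x)) \<in> borel_measurable lebesgue"
    by (intro borel_measurable_continuous_on[where f = cnj] continuous_intros) simp
  have bound: "cmod (cnj (f x) * g x) \<le> (cmod (f x))\<^sup>2 + (cmod (g x))\<^sup>2" for x
  proof -
    have "2 * (cmod (f x) * cmod (g x)) \<le> (cmod (f x))\<^sup>2 + (cmod (g x))\<^sup>2"
      using zero_le_power2[of "cmod (f x) - cmod (g x)"] by (simp add: power2_diff)
    moreover have "0 \<le> cmod (f x) * cmod (g x)" by simp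
    ultimately show ?thesis unfolding norm_mult complex_mod_cnj by linarith
  qed
  have "integrable lebesgue (\<lambda>x. (cmod (f x))\<^sup>2 + (cmod (g x))\<^sup>2)"
    using assms by (simp add: square_integrable_def)
  then show ?thesis
    by (rule Bochner_Integration.integrable_bound) (use bound in auto)
qed


section \<open>The space of square-integrable functions modulo null sets\<close>

quotient_type (overloaded) 'a L2 = "'a::euclidean_space \<Rightarrow> complex" / partial:
  "\<lambda>f g. square_integrable f \<and> square_integrable g \<and> (AE x in lebesgue. f x = g x)"
proof (rule part_equivpI)
  show "\<exists>f :: 'a \<Rightarrow> complex. square_integrable f \<and> square_integrable f \<and> (AE x in lebesgue. f x = f x)"
    using square_integrable_zero by auto
  show "symp (\<lambda>f g :: 'a \<Rightarrow> complex.
          square_integrable f \<and> square_integrable g \<and> (AE x in lebesgue. f x = g x))"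
    by (rule sympI) (auto elim: AE_mp)
  show "transp (\<lambda>f g :: 'a \<Rightarrow> complex.
          square_integrable f \<and> square_integrable g \<and> (AE x in lebesgue. f x = g x))"
  proof (rule transpI, elim conjE, intro conjI)
    fix f g h :: "'a \<Rightarrow> complex"
    assume "AE x in lebesgue. f x = g x" "AE x in lebesgue. g x = h x"
    then show "AE x in lebesgue. f x = h x" by eventually_elim simp
  qed
qed

instantiation L2 :: (euclidean_space) complex_inner
begin

lift_definition zero_L2 :: "'a L2" is "\<lambda>x. 0"
  by (simp add: square_integrable_zero)

lift_definition plus_L2 :: "'a L2 \<Rightarrow> 'a L2 \<Rightarrow> 'a L2" is "\<lambda>f g x. f x + g x"
  by (auto intro: square_integrable_add)

lift_definition uminus_L2 :: "'a L2 \<Rightarrow> 'a L2" is "\<lambda>f x. - f x"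
  by (auto intro: square_integrable_uminus)

lift_definition minus_L2 :: "'a L2 \<Rightarrow> 'a L2 \<Rightarrow> 'a L2" is "\<lambda>f g x. f x - g x"
  by (auto intro: square_integrable_diff)

lift_definition scaleC_L2 :: "complex \<Rightarrow> 'a L2 \<Rightarrow> 'a L2" is "\<lambda>a f x. a * f x"
  by (auto intro: square_integrable_scale)

definition scaleR_L2 :: "real \<Rightarrow> 'a L2 \<Rightarrow> 'a L2" where
  "scaleR_L2 r f = complex_of_real r *\<^sub>C f"

lift_definition cinner_L2 :: "'a L2 \<Rightarrow> 'a L2 \<Rightarrow> complex"
  is "\<lambda>f g. LINT x|lebesgue. cnj (f x) * g x"
proof (elim conjE)
  fix f f' g g' :: "'a \<Rightarrow> complex"
  assume si: "square_integrable f" "square_integrable f'" "square_integrable g" "square_integrable g'"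
    and ae: "AE x in lebesgue. f x = f' x" "AE x in lebesgue. g x = g' x"
  from ae have "AE x in lebesgue. cnj (f x) * g x = cnj (f' x) * g' x"
    by eventually_elim simp
  then show "(LINT x|lebesgue. cnj (f x) * g x) = (LINT x|lebesgue. cnj (f' x) * g' x)"
    by (intro integral_cong_AE borel_measurable_integrable square_integrable_product si)
qed

definition inner_L2 :: "'a L2 \<Rightarrow> 'a L2 \<Rightarrow> real" where
  "inner_L2 f g = Re (cinner f g)"

definition norm_L2 :: "'a L2 \<Rightarrow> real" where
  "norm_L2 f = sqrt (inner f f)"

definition sgn_L2 :: "'a L2 \<Rightarrow> 'a L2" where
  "sgn_L2 f = scaleR (inverse (norm f)) f"

definition dist_L2 :: "'a L2 \<Rightarrow> 'a L2 \<Rightarrow> real" where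
  "dist_L2 f g = norm (f - g)"

definition uniformity_L2 :: "('a L2 \<times> 'a L2) filter" where
  "uniformity_L2 = (INF e\<in>{0 <..}. principal {(f, g). dist f g < e})"

definition open_L2 :: "'a L2 set \<Rightarrow> bool" where
  "open_L2 U \<longleftrightarrow> (\<forall>f\<in>U. eventually (\<lambda>(f', g). f' = f \<longrightarrow> g \<in> U) uniformity)"

instance
proof
  fix a b :: complex and r s :: real and f g h :: "'a L2" and U :: "'a L2 set"
  show "f + g + h = f + (g + h)"
    by transfer (auto simp: add.assoc intro!: square_integrable_add)
  show "f + g = g + f"
    by transfer (auto simp: add.commute intro!: square_integrable_add)
  show "0 + f = f"
    by transfer auto
  show "- f + f = 0"
    by transfer (auto simp: square_integrable_zero)
  show "f - g = f + - g"
    by transfer (auto intro: square_integrable_add square_integrable_diff square_integrable_uminus)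
  show "a *\<^sub>C (f + g) = a *\<^sub>C f + a *\<^sub>C g" for a and f g :: "'a L2"
    by transfer
      (auto simp: distrib_left intro!: square_integrable_add square_integrable_scale)
  then show "r *\<^sub>R (f + g) = r *\<^sub>R f + r *\<^sub>R g"
    by (simp add: scaleR_L2_def)
  show "(a + b) *\<^sub>C f = a *\<^sub>C f + b *\<^sub>C f" for a b and f :: "'a L2"
    by transfer
      (auto simp: distrib_right intro!: square_integrable_add square_integrable_scale)
  then show "(r + s) *\<^sub>R f = r *\<^sub>R f + s *\<^sub>R f"
    by (simp add: scaleR_L2_def)
  show "a *\<^sub>C (b *\<^sub>C f) = (a * b) *\<^sub>C f" for a b and f :: "'a L2"
    by transfer (auto simp: mult.assoc intro!: square_integrable_scale)
  then show "r *\<^sub>R s *\<^sub>R f = (r * s) *\<^sub>R f"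
    by (simp add: scaleR_L2_def)
  show "1 *\<^sub>R f = f"
    unfolding scaleR_L2_def by transfer auto
  show "complex_of_real r *\<^sub>C f = r *\<^sub>R f"
    by (simp add: scaleR_L2_def)
  show "sgn f = scaleR (inverse (norm f)) f"
    by (rule sgn_L2_def)
  show "dist f g = norm (f - g)"
    by (rule dist_L2_def)
  show "(uniformity :: ('a L2 \<times> 'a L2) filter) = (INF e\<in>{0 <..}. principal {(x, y). dist x y < e})"
    by (rule uniformity_L2_def)
  show "open U \<longleftrightarrow> (\<forall>x\<in>U. eventually (\<lambda>(x', y). x' = x \<longrightarrow> y \<in> U) uniformity)"
    by (rule open_L2_def)
  show comm: "cinner f g = cnj (cinner g f)" for f g :: "'a L2"
    by transfer (subst Bochner_Integration.integral_cnj[symmetric], simp add: mult.commute)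
  show add: "cinner (f + g) h = cinner f h + cinner g h" for f g h :: "'a L2"
    by transfer (simp add: distrib_right square_integrable_product)
  show scale: "cinner (a *\<^sub>C f) g = cnj a * cinner f g" for a and f g :: "'a L2"
    by transfer (simp add: mult.assoc)
  show "inner f g = Re (cinner f g)"
    by (rule inner_L2_def)
  show "inner f g = inner g f"
    unfolding inner_L2_def by (subst comm) simp
  show "inner (f + g) h = inner f h + inner g h"
    by (simp add: inner_L2_def add)
  show "inner (r *\<^sub>R f) g = r * inner f g"
    by (simp add: inner_L2_def scaleR_L2_def scale)
  have inner_self: "Re (LINT x|lebesgue. cnj (u x) * u x) = (LINT x|lebesgue. (cmod (u x))\<^sup>2)"
    for u :: "'a \<Rightarrow> complex"
  proof -
    have "(LINT x|lebesgue. cnj (u x) * u x)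
        = (LINT x|lebesgue. complex_of_real ((cmod (u x))\<^sup>2))"
      by (intro Bochner_Integration.integral_cong refl)
        (simp only: complex_norm_square mult.commute)
    then show ?thesis by (simp only: integral_complex_of_real Re_complex_of_real)
  qed
  show "0 \<le> inner f f"
    unfolding inner_L2_def by transfer (simp only: inner_self, simp)
  show "inner f f = 0 \<longleftrightarrow> f = 0"
    unfolding inner_L2_def
  proof transfer
    fix u :: "'a \<Rightarrow> complex"
    assume "square_integrable u \<and> square_integrable u \<and> (AE x in lebesgue. u x = u x)"
    then have u: "square_integrable u" by simp
    then have "integrable lebesgue (\<lambda>x. (cmod (u x))\<^sup>2)"
      by (simp add: square_integrable_def)
    then have "(LINT x|lebesgue. (cmod (u x))\<^sup>2) = 0 \<longleftrightarrow> (AE x in lebesgue. (cmod (u x))\<^sup>2 = 0)"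
      by (intro integral_nonneg_eq_0_iff_AE) auto
    then show "(Re (LINT x|lebesgue. cnj (u x) * u x) = 0) \<longleftrightarrow>
        (square_integrable u \<and> square_integrable (\<lambda>x::'a. 0) \<and> (AE x in lebesgue. u x = 0))"
      using u by (simp add: inner_self square_integrable_zero)
  qed
  show "norm f = sqrt (inner f f)"
    by (rule norm_L2_def)
qed

end

text \<open>
  The elements of \<open>L\<^sup>2(\<Omega>)\<close> are represented by their extensions by zero: \<open>L2_on \<Omega>\<close> is the closed
  subspace of the classes that vanish almost everywhere outside \<open>\<Omega>\<close>. The inner product of two such
  classes is an integral over \<open>\<Omega>\<close>.
\<close>

lift_definition vanishes_off :: "'a::euclidean_space set \<Rightarrow> 'a L2 \<Rightarrow> bool"
  is "\<lambda>\<Omega> f. AE x in lebesgue. x \<notin> \<Omega> \<longrightarrow> f x = 0"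
proof (elim conjE)
  fix \<Omega> :: "'a set" and f g :: "'a \<Rightarrow> complex"
  assume ae: "AE x in lebesgue. f x = g x"
  show "(AE x in lebesgue. x \<notin> \<Omega> \<longrightarrow> f x = 0) \<longleftrightarrow> (AE x in lebesgue. x \<notin> \<Omega> \<longrightarrow> g x = 0)"
  proof (rule eventually_subst)
    show "AE x in lebesgue. (x \<notin> \<Omega> \<longrightarrow> f x = 0) = (x \<notin> \<Omega> \<longrightarrow> g x = 0)"
      using ae by eventually_elim simp
  qed
qed

definition L2_on :: "'a::euclidean_space set \<Rightarrow> 'a L2 set" where
  "L2_on \<Omega> = {f. vanishes_off \<Omega> f}"

definition L2_vec_on :: "(real^'n) set \<Rightarrow> ((real^'n) L2 ^ 'n) set" where
  "L2_vec_on \<Omega> = {q. \<forall>k. q $ k \<in> L2_on \<Omega>}"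

definition Linfty_on :: "'a::euclidean_space set \<Rightarrow> ('a \<Rightarrow> real) set" where
  "Linfty_on \<Omega> = {p. p \<in> borel_measurable (lebesgue_on \<Omega>) \<and>
                      (\<exists>C. AE x in lebesgue_on \<Omega>. \<bar>p x\<bar> \<le> C)}"

text \<open>
  Only the values of \<open>p\<close> on \<open>\<Omega>\<close> matter; \<open>p\<close> need not even be measurable outside \<open>\<Omega>\<close>.
\<close>

definition mult_on :: "'a::euclidean_space set \<Rightarrow> ('a \<Rightarrow> real) \<Rightarrow> 'a L2 \<Rightarrow> 'a L2" where
  "mult_on \<Omega> p f = abs_L2 (\<lambda>x. if x \<in> \<Omega> then complex_of_real (p x) * rep_L2 f x else 0)"


section \<open>Unbounded operators\<close>

text \<open>
  An operator from \<open>H\<close> to \<open>K\<close> is given by its graph, so that its domain is \<^const>\<open>Domain\<close>.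
\<close>

definition linear_operator ::
    "'a::complex_inner set \<Rightarrow> 'b::complex_inner set \<Rightarrow> ('a \<times> 'b) set \<Rightarrow> bool" where
  "linear_operator H K T \<longleftrightarrow>
     T \<subseteq> H \<times> K \<and> single_valued T \<and> (0, 0) \<in> T \<and>
     (\<forall>(x, y)\<in>T. \<forall>(x', y')\<in>T. (x + x', y + y') \<in> T) \<and>
     (\<forall>a. \<forall>(x, y)\<in>T. (a *\<^sub>C x, a *\<^sub>C y) \<in> T)"

definition densely_defined :: "'a::complex_inner set \<Rightarrow> ('a \<times> 'b) set \<Rightarrow> bool" where
  "densely_defined H T \<longleftrightarrow> Domain T \<subseteq> H \<and> H \<subseteq> closure (Domain T)"

definition op_app :: "('a \<times> 'b) set \<Rightarrow> 'a \<Rightarrow> 'b" where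
  "op_app T x = (THE y. (x, y) \<in> T)"

definition hilbert_adjoint ::
    "'a::complex_inner set \<Rightarrow> 'b::complex_inner set \<Rightarrow> ('a \<times> 'b) set \<Rightarrow> ('b \<times> 'a) set" where
  "hilbert_adjoint H K T =
     {(y, z). y \<in> K \<and> z \<in> H \<and> (\<forall>(x, w)\<in>T. cinner y w = cinner z x)}"

definition self_adjoint :: "'a::complex_inner set \<Rightarrow> ('a \<times> 'a) set \<Rightarrow> bool" where
  "self_adjoint H T \<longleftrightarrow>
     linear_operator H H T \<and> densely_defined H T \<and> hilbert_adjoint H H T = T"


section \<open>Test functions, weak derivatives and Sobolev spaces\<close>

definition partial_deriv :: "'n::finite \<Rightarrow> (real^'n \<Rightarrow> complex) \<Rightarrow> real^'n \<Rightarrow> complex" where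
  "partial_deriv k f x = vector_derivative (\<lambda>t. f (x + t *\<^sub>R axis k 1)) (at 0)"

primrec C_diff :: "nat \<Rightarrow> (real^'n \<Rightarrow> complex) \<Rightarrow> bool" where
  "C_diff 0 f \<longleftrightarrow> continuous_on UNIV f"
| "C_diff (Suc m) f \<longleftrightarrow> (\<forall>x. f differentiable (at x)) \<and> (\<forall>k. C_diff m (partial_deriv k f))"

text \<open>Elements of \<open>C\<^sub>0\<^sup>\<infinity>(\<Omega>)\<close>, extended by zero.\<close>

definition test_fun :: "(real^'n) set \<Rightarrow> (real^'n \<Rightarrow> complex) set" where
  "test_fun \<Omega> = {f. (\<forall>m. C_diff m f) \<and>
                     compact (closure {x. f x \<noteq> 0}) \<and> closure {x. f x \<noteq> 0} \<subseteq> \<Omega>}"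

definition partial0 :: "(real^'n) set \<Rightarrow> 'n \<Rightarrow> ((real^'n) L2 \<times> (real^'n) L2) set" where
  "partial0 \<Omega> k = {(abs_L2 f, abs_L2 (partial_deriv k f)) | f. f \<in> test_fun \<Omega>}"

definition weak_partial :: "(real^'n) set \<Rightarrow> 'n \<Rightarrow> ((real^'n) L2 \<times> (real^'n) L2) set" where
  "weak_partial \<Omega> k =
     {(f, - g) | f g. (f, g) \<in> hilbert_adjoint (L2_on \<Omega>) (L2_on \<Omega>) (partial0 \<Omega> k)}"

definition W1 :: "(real^'n) set \<Rightarrow> (real^'n) L2 set" where
  "W1 \<Omega> = (\<Inter>k. Domain (weak_partial \<Omega> k))"

definition W1_norm :: "(real^'n) set \<Rightarrow> (real^'n) L2 \<Rightarrow> real" where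
  "W1_norm \<Omega> f = sqrt ((norm f)\<^sup>2 + (\<Sum>k\<in>UNIV. (norm (op_app (weak_partial \<Omega> k) f))\<^sup>2))"

definition W1_0 :: "(real^'n) set \<Rightarrow> (real^'n) L2 set" where
  "W1_0 \<Omega> = {f \<in> W1 \<Omega>. \<forall>\<epsilon>>0. \<exists>\<phi>\<in>test_fun \<Omega>. W1_norm \<Omega> (f - abs_L2 \<phi>) < \<epsilon>}"

definition nabla0 :: "(real^'n) set \<Rightarrow> ((real^'n) L2 \<times> ((real^'n) L2 ^ 'n)) set" where
  "nabla0 \<Omega> = {(abs_L2 f, \<chi> k. abs_L2 (partial_deriv k f)) | f. f \<in> test_fun \<Omega>}"

definition nabla0_adj :: "(real^'n) set \<Rightarrow> (((real^'n) L2 ^ 'n) \<times> (real^'n) L2) set" where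
  "nabla0_adj \<Omega> = hilbert_adjoint (L2_on \<Omega>) (L2_vec_on \<Omega>) (nabla0 \<Omega>)"

definition nabla_w :: "(real^'n) set \<Rightarrow> (real^'n) L2 \<Rightarrow> ((real^'n) L2 ^ 'n)" where
  "nabla_w \<Omega> u = (\<chi> k. op_app (weak_partial \<Omega> k) u)"

definition A_hat ::
    "(real^'n) set \<Rightarrow> (real^'n \<Rightarrow> real) \<Rightarrow>
      (((real^'n) L2 \<times> ((real^'n) L2 ^ 'n)) \<times> ((real^'n) L2 \<times> ((real^'n) L2 ^ 'n))) set" where
  "A_hat \<Omega> p =
     {((u, q), (op_app (nabla0_adj \<Omega>) q, nabla_w \<Omega> u - (\<chi> k. mult_on \<Omega> p (q $ k)))) | u q.
        u \<in> W1_0 \<Omega> \<and> q \<in> Domain (nabla0_adj \<Omega>)}"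

end

theory Submission
  imports Defs
begin

text \<open>
  Let \<open>T\<close> be the gradient on test functions, \<open>R\<close> its closure and \<open>S\<close> its adjoint. The space \<open>W1_0\<close>
  with its norm is built so that \<open>R\<close> is exactly the weak gradient on \<open>W1_0\<close>
  (\<open>closure_nabla0_iff\<close>). Hence the operator is \<open>(u, q) \<mapsto> (S q, R u - p q)\<close>, the sum of an off-diagonal
  operator, whose two entries are adjoint to each other, and of a bounded symmetric diagonal term.

  Such an operator is self-adjoint for general Hilbert space reasons
  (\<open>self_adjoint_block_operator\<close>): testing the adjoint relation on the two components separately
  characterizes the first component of a vector in the domain of the adjoint by the double adjoint
  of \<open>T\<close> and the second by \<open>S\<close>. That the double adjoint is the closure is the theorem on double
  orthogonal complements, applied to the graph of \<open>T\<close>. It rests on orthogonal projections and so on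
  the completeness of the space of square-integrable functions (Riesz--Fischer).

  What remains is that \<open>T\<close> and \<open>S\<close> are densely defined. Both follow from two facts on test functions:
  a function in \<open>L2_on \<Omega>\<close> that is orthogonal to all of them is zero
  (\<open>orthogonal_to_test_fun_eq_zero\<close>, by smooth approximation of indicator functions of boxes),
  and they admit integration by parts (\<open>integration_by_parts_test_fun\<close>), which puts the fields with
  test functions as components into the domain of \<open>S\<close>. A subspace with trivial orthogonal complement
  is dense, again by projection.
\<close>

section \<open>Complex inner product spaces\<close>

lemma scaleC_minus_one: "(- 1) *\<^sub>C x = - (x :: 'a::complex_inner)"
  using scaleC_of_real[of "- 1" x] by simp

lemma scaleC_zero_left [simp]: "0 *\<^sub>C x = (0 :: 'a::complex_inner)"
  using scaleC_of_real[of 0 x] by simp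

lemma scaleC_zero_right [simp]: "a *\<^sub>C 0 = (0 :: 'a::complex_inner)"
  using scaleC_add_right[of a 0 0] by simp

lemma scaleC_diff_right: "a *\<^sub>C (x - y) = a *\<^sub>C x - a *\<^sub>C (y :: 'a::complex_inner)"
  using scaleC_add_right[of a "x - y" y] by (simp add: algebra_simps)

lemma cinner_zero_left [simp]: "cinner 0 (x :: 'a::complex_inner) = 0"
  using cinner_add_left[of 0 0 x] by simp

lemma cinner_zero_right [simp]: "cinner (x :: 'a::complex_inner) 0 = 0"
  using cinner_commute[of x 0] by simp

lemma cinner_minus_left: "cinner (- x) (y :: 'a::complex_inner) = - cinner x y"
  using cinner_add_left[of x "- x" y] by (simp add: eq_neg_iff_add_eq_0 add.commute)

lemma cinner_diff_left: "cinner (x - y) (z :: 'a::complex_inner) = cinner x z - cinner y z"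
  using cinner_add_left[of x "- y" z] by (simp add: cinner_minus_left)

lemma cinner_add_right: "cinner (x :: 'a::complex_inner) (y + z) = cinner x y + cinner x z"
  using cinner_commute[of x "y + z"] cinner_commute[of x y] cinner_commute[of x z]
  by (simp add: cinner_add_left)

lemma cinner_minus_right: "cinner (x :: 'a::complex_inner) (- y) = - cinner x y"
  using cinner_commute[of x "- y"] cinner_commute[of x y] by (simp add: cinner_minus_left)

lemma cinner_diff_right: "cinner (x :: 'a::complex_inner) (y - z) = cinner x y - cinner x z"
  using cinner_add_right[of x y "- z"] by (simp add: cinner_minus_right)

lemma cinner_scaleC_right: "cinner (x :: 'a::complex_inner) (a *\<^sub>C y) = a * cinner x y"
  using cinner_commute[of x "a *\<^sub>C y"] cinner_commute[of x y] by (simp add: cinner_scaleC_left)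

lemma cinner_eq_inner:
  "cinner (x :: 'a::complex_inner) y = Complex (inner x y) (inner (\<i> *\<^sub>C x) y)"
  by (simp add: complex_eq_iff inner_eq_Re_cinner cinner_scaleC_left)

lemma cinner_self_eq_zero: "cinner x x = 0 \<longleftrightarrow> x = (0 :: 'a::complex_inner)"
  using inner_eq_zero_iff[of x] inner_eq_Re_cinner[of x x] by auto

lemma norm_scaleC: "norm (a *\<^sub>C x) = cmod a * norm (x :: 'a::complex_inner)"
proof -
  have "cinner (a *\<^sub>C x) (a *\<^sub>C x) = complex_of_real ((cmod a)\<^sup>2) * cinner x x"
    unfolding complex_norm_square
    by (simp add: cinner_scaleC_left cinner_scaleC_right ac_simps)
  then have "(norm (a *\<^sub>C x))\<^sup>2 = (cmod a * norm x)\<^sup>2"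
    unfolding power_mult_distrib power2_norm_eq_inner inner_eq_Re_cinner by simp
  then show ?thesis by simp
qed

lemma tendsto_scaleC:
  assumes "(f \<longlongrightarrow> (l :: 'a::complex_inner)) F"
  shows "((\<lambda>x. a *\<^sub>C f x) \<longlongrightarrow> a *\<^sub>C l) F"
proof -
  have "bounded_linear (\<lambda>x :: 'a. a *\<^sub>C x)"
  proof (rule bounded_linear_intro[where K = "cmod a"])
    show "a *\<^sub>C r *\<^sub>R x = r *\<^sub>R a *\<^sub>C x" for r and x :: 'a
      by (simp flip: scaleC_of_real add: scaleC_scaleC mult.commute)
  qed (simp_all add: scaleC_add_right norm_scaleC mult.commute)
  then show ?thesis using assms by (rule bounded_linear.tendsto)
qed

lemma tendsto_cinner:
  assumes "(f \<longlongrightarrow> (l :: 'a::complex_inner)) F" "(g \<longlongrightarrow> m) F"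
  shows "((\<lambda>x. cinner (f x) (g x)) \<longlongrightarrow> cinner l m) F"
  unfolding cinner_eq_inner Complex_eq using assms by (intro tendsto_intros tendsto_scaleC)

definition csubspace :: "'a::complex_inner set \<Rightarrow> bool" where
  "csubspace S \<longleftrightarrow> 0 \<in> S \<and> (\<forall>x\<in>S. \<forall>y\<in>S. x + y \<in> S) \<and> (\<forall>a. \<forall>x\<in>S. a *\<^sub>C x \<in> S)"

lemma csubspaceD:
  assumes "csubspace S"
  shows csubspace_0: "0 \<in> S"
    and csubspace_add: "x \<in> S \<Longrightarrow> y \<in> S \<Longrightarrow> x + y \<in> S"
    and csubspace_scaleC: "x \<in> S \<Longrightarrow> a *\<^sub>C x \<in> S"
    and csubspace_minus: "x \<in> S \<Longrightarrow> - x \<in> S"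
    and csubspace_diff: "x \<in> S \<Longrightarrow> y \<in> S \<Longrightarrow> x - y \<in> S"
    and csubspace_imp_subspace: "subspace S"
proof -
  show add: "x \<in> S \<Longrightarrow> y \<in> S \<Longrightarrow> x + y \<in> S" for x y
    using assms by (simp add: csubspace_def)
  show minus: "x \<in> S \<Longrightarrow> - x \<in> S" for x
    using assms unfolding csubspace_def scaleC_minus_one[symmetric] by blast
  show "x \<in> S \<Longrightarrow> y \<in> S \<Longrightarrow> x - y \<in> S"
    using add[of x "- y"] minus[of y] by simp
  show "subspace S"
    using assms unfolding csubspace_def subspace_def scaleC_of_real[symmetric] by blast
qed (use assms in \<open>simp_all add: csubspace_def\<close>)

lemma csubspace_closure:
  assumes "csubspace S"
  shows "csubspace (closure S)"
  unfolding csubspace_def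
proof (intro conjI ballI allI)
  show "0 \<in> closure S" using csubspace_0[OF assms] closure_subset by blast
  fix x y assume "x \<in> closure S" "y \<in> closure S"
  then obtain f g where f: "\<And>n. f n \<in> S" "f \<longlonglongrightarrow> x" and g: "\<And>n. g n \<in> S" "g \<longlonglongrightarrow> y"
    unfolding closure_sequential by blast
  then show "x + y \<in> closure S"
    unfolding closure_sequential
    by (intro exI[of _ "\<lambda>n. f n + g n"]) (auto intro!: tendsto_add csubspace_add[OF assms])
  show "a *\<^sub>C x \<in> closure S" for a
    unfolding closure_sequential using f
    by (intro exI[of _ "\<lambda>n. a *\<^sub>C f n"]) (auto intro!: tendsto_scaleC csubspace_scaleC[OF assms])
qed

lemma csubspace_Times: "csubspace S \<Longrightarrow> csubspace T \<Longrightarrow> csubspace (S \<times> T)"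
  by (auto simp: csubspace_def scaleC_prod_def zero_prod_def)

section \<open>Orthogonal complements in Hilbert spaces\<close>

text \<open>
  By the parallelogram law every minimizing sequence for the distance from \<open>x\<close> to \<open>S\<close> is a Cauchy
  sequence, and at the minimum the variation in each direction of \<open>S\<close> vanishes.
\<close>

lemma orthogonal_projection_exists:
  fixes S :: "'a::{real_inner, complete_space} set"
  assumes S: "subspace S" and cl: "closed S"
  obtains y where "y \<in> S" "\<And>z. z \<in> S \<Longrightarrow> inner (x - y) z = 0"
proof -
  have [simp]: "S \<noteq> {}" using subspace_0[OF S] by blast
  define d where "d = infdist x S"
  have d_le: "d \<le> norm (x - y)" if "y \<in> S" for y
    unfolding d_def using that infdist_le[of y S x] by (simp add: dist_norm)
  have d0: "0 \<le> d" by (simp add: d_def infdist_nonneg)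
  have "\<exists>y\<in>S. norm (x - y) < d + inverse (real (Suc n))" for n
  proof -
    have "infdist x S < d + inverse (real (Suc n))" by (simp add: d_def)
    then show ?thesis
      unfolding infdist_def using cInf_lessD[of "dist x ` S"] by (auto simp: dist_norm)
  qed
  then obtain y where y: "\<And>n. y n \<in> S" "\<And>n. norm (x - y n) < d + inverse (real (Suc n))"
    by metis
  have lim: "(\<lambda>n. norm (x - y n)) \<longlonglongrightarrow> d"
  proof (rule tendsto_sandwich[OF _ _ tendsto_const])
    show "(\<lambda>n. d + inverse (real (Suc n))) \<longlonglongrightarrow> d"
      using tendsto_add[OF tendsto_const LIMSEQ_inverse_real_of_nat] by simp
  qed (use y d_le in \<open>auto intro!: always_eventually less_imp_le\<close>)
  have para: "(norm (y m - y n))\<^sup>2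
      \<le> 2 * (norm (x - y m))\<^sup>2 + 2 * (norm (x - y n))\<^sup>2 - 4 * d\<^sup>2" for m n
  proof -
    have mid: "(1/2) *\<^sub>R (y m + y n) \<in> S"
      using S y(1) by (intro subspace_scale subspace_add)
    have "d\<^sup>2 \<le> (norm (x - (1/2) *\<^sub>R (y m + y n)))\<^sup>2"
      using d_le[OF mid] d0 by (intro power_mono)
    then show ?thesis
      unfolding power2_norm_eq_inner
      by (simp add: inner_diff_left inner_diff_right inner_add_left inner_add_right
          inner_commute field_simps)
  qed
  have "Cauchy y"
  proof (rule metric_CauchyI)
    fix e :: real assume e: "0 < e"
    have "(\<lambda>n. (norm (x - y n))\<^sup>2) \<longlonglongrightarrow> d\<^sup>2"
      using lim by (intro tendsto_intros)
    then have "eventually (\<lambda>n. (norm (x - y n))\<^sup>2 < d\<^sup>2 + e\<^sup>2 / 4) sequentially"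
      using e by (intro order_tendstoD) auto
    then obtain N where N: "\<And>n. n \<ge> N \<Longrightarrow> (norm (x - y n))\<^sup>2 < d\<^sup>2 + e\<^sup>2 / 4"
      by (auto simp: eventually_sequentially)
    show "\<exists>M. \<forall>m\<ge>M. \<forall>n\<ge>M. dist (y m) (y n) < e"
    proof (intro exI allI impI)
      fix m n assume "N \<le> m" "N \<le> n"
      then have "(norm (y m - y n))\<^sup>2 < e\<^sup>2"
        using para[of m n] N[of m] N[of n] by simp
      then show "dist (y m) (y n) < e"
        using e by (simp add: dist_norm power_less_imp_less_base)
    qed
  qed
  then obtain y0 where y0: "y \<longlonglongrightarrow> y0" using convergent_eq_Cauchy by blast
  have y0S: "y0 \<in> S" using closed_sequentially[OF cl] y(1) y0 by blast
  have "(\<lambda>n. norm (x - y n)) \<longlonglongrightarrow> norm (x - y0)" using y0 by (intro tendsto_intros)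
  then have norm_y0: "norm (x - y0) = d" using lim LIMSEQ_unique by blast
  have "inner (x - y0) z = 0" if z: "z \<in> S" for z
  proof (rule ccontr)
    assume ne: "inner (x - y0) z \<noteq> 0"
    then have zz: "inner z z > 0" by auto
    \<comment> \<open>the minimizer of the quadratic polynomial \<open>t \<mapsto> (norm (x - y0 - t z))\<^sup>2\<close>\<close>
    define t where "t = inner (x - y0) z / inner z z"
    have "y0 + t *\<^sub>R z \<in> S" using S y0S z by (intro subspace_scale subspace_add)
    from d_le[OF this] have "(norm (x - y0))\<^sup>2 \<le> (norm (x - y0 - t *\<^sub>R z))\<^sup>2"
      using norm_y0 d0 by (intro power_mono) (auto simp: algebra_simps)
    also have "\<dots> = (norm (x - y0))\<^sup>2 - 2 * t * inner (x - y0) z + t\<^sup>2 * inner z z"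
      unfolding power2_norm_eq_inner
      by (simp add: inner_diff_left inner_diff_right inner_commute power2_eq_square algebra_simps)
    also have "\<dots> = (norm (x - y0))\<^sup>2 - (inner (x - y0) z)\<^sup>2 / inner z z"
      using zz by (simp add: t_def power2_eq_square field_simps)
    finally show False using ne zz by (simp add: divide_le_0_iff)
  qed
  then show thesis using that y0S by blast
qed

text \<open>
  The orthogonal complement of a complex subspace is the same for the complex and for the real
  inner product; so the real projection theorem applies, and the double orthogonal complement within
  a closed subspace \<open>H\<close> is the closure.
\<close>

lemma in_closure_if_orthogonal_to_complement:
  fixes S :: "'a::{complex_inner, complete_space} set"
  assumes H: "csubspace H" "closed H" and S: "csubspace S" "S \<subseteq> H" and x: "x \<in> H"
    and orth: "\<And>z. z \<in> H \<Longrightarrow> (\<And>y. y \<in> S \<Longrightarrow> cinner z y = 0) \<Longrightarrow> cinner z x = 0"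
  shows "x \<in> closure S"
proof -
  have cS: "csubspace (closure S)" using S(1) by (rule csubspace_closure)
  then obtain y where y: "y \<in> closure S" "\<And>z. z \<in> closure S \<Longrightarrow> inner (x - y) z = 0"
    using orthogonal_projection_exists[OF csubspace_imp_subspace closed_closure] by blast
  have co: "cinner (x - y) z = 0" if "z \<in> closure S" for z
  proof -
    have "inner (\<i> *\<^sub>C (x - y)) z = inner (x - y) ((- \<i>) *\<^sub>C z)"
      by (simp add: inner_eq_Re_cinner cinner_scaleC_left cinner_scaleC_right)
    also have "\<dots> = 0" using y(2) csubspace_scaleC[OF cS that] by blast
    finally show ?thesis using y(2)[OF that] by (simp add: cinner_eq_inner complex_eq_iff)
  qed
  have "y \<in> H" using y(1) closure_minimal[OF S(2) H(2)] by blast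
  then have "x - y \<in> H" using csubspace_diff[OF H(1) x] by blast
  then have "cinner (x - y) x = 0"
    using orth co closure_subset by blast
  then have "cinner (x - y) (x - y) = 0"
    using co[OF y(1)] by (simp add: cinner_diff_right)
  then show ?thesis using y(1) by (simp add: cinner_self_eq_zero)
qed

section \<open>Self-adjointness of off-diagonal block operators\<close>

lemma linear_operator_csubspace: "linear_operator H K T \<Longrightarrow> csubspace T"
  unfolding linear_operator_def csubspace_def
  by (auto simp: scaleC_prod_def zero_prod_def plus_prod_def case_prod_beta)

lemma csubspace_hilbert_adjoint:
  "csubspace H \<Longrightarrow> csubspace K \<Longrightarrow> csubspace (hilbert_adjoint H K T)"
  unfolding hilbert_adjoint_def csubspace_def
  by (auto simp: scaleC_prod_def zero_prod_def plus_prod_def cinner_add_left cinner_scaleC_left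
      case_prod_beta)

text \<open>The adjoint relation passes to the closure of the graph, as both sides are continuous.\<close>

lemma hilbert_adjoint_closure:
  assumes "(y, z) \<in> hilbert_adjoint H K T" "(x, w) \<in> closure T"
  shows "cinner y w = cinner z x"
proof -
  from assms(2) obtain s where s: "\<And>n. s n \<in> T" "s \<longlonglongrightarrow> (x, w)"
    unfolding closure_sequential by blast
  have eq: "cinner y (snd (s n)) = cinner z (fst (s n))" for n
    using assms(1) s(1)[of n] by (cases "s n") (auto simp: hilbert_adjoint_def)
  have "(\<lambda>n. cinner y (snd (s n))) \<longlonglongrightarrow> cinner y w"
    using tendsto_snd[OF s(2)] by (intro tendsto_cinner tendsto_const) simp
  moreover have "(\<lambda>n. cinner y (snd (s n))) \<longlonglongrightarrow> cinner z x"
    unfolding eq using tendsto_fst[OF s(2)] by (intro tendsto_cinner tendsto_const) simp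
  ultimately show ?thesis by (rule LIMSEQ_unique)
qed

lemma dense_orthogonal_eq_zero:
  assumes "H \<subseteq> closure D" "(x :: 'a::complex_inner) \<in> H" "\<And>y. y \<in> D \<Longrightarrow> cinner x y = 0"
  shows "x = 0"
proof -
  have "x \<in> closure D" using assms by blast
  then obtain s where s: "\<And>n. s n \<in> D" "s \<longlonglongrightarrow> x"
    unfolding closure_sequential by blast
  have "(\<lambda>n. cinner x (s n)) \<longlonglongrightarrow> cinner x x"
    using s(2) by (intro tendsto_cinner tendsto_const)
  moreover have "cinner x (s n) = 0" for n using assms(3) s(1) by blast
  ultimately have "cinner x x = 0" using LIMSEQ_unique[OF _ tendsto_const] by force
  then show ?thesis by (simp add: cinner_self_eq_zero)
qed

lemma single_valued_hilbert_adjoint: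
  assumes H: "csubspace H" and d: "densely_defined H T"
  shows "single_valued (hilbert_adjoint H K T)"
proof (rule single_valuedI)
  fix y z z' assume "(y, z) \<in> hilbert_adjoint H K T" "(y, z') \<in> hilbert_adjoint H K T"
  then have z: "z \<in> H" "z' \<in> H" and eq: "\<forall>(x, w)\<in>T. cinner (z - z') x = 0"
    by (fastforce simp: hilbert_adjoint_def cinner_diff_left)+
  have "z - z' = 0"
    using d eq csubspace_diff[OF H z]
    by (intro dense_orthogonal_eq_zero[of H "Domain T"]) (auto simp: densely_defined_def)
  then show "z = z'" by simp
qed

text \<open>
  A densely defined adjoint makes an operator closable: two limits over the same point have the same
  inner products with the domain of the adjoint.
\<close>

lemma single_valued_closure:
  assumes K: "csubspace K" "closed K" and H: "closed H" and T: "linear_operator H K T"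
    and d: "densely_defined K (hilbert_adjoint H K T)"
  shows "single_valued (closure T)"
proof (rule single_valuedI)
  have sub: "closure T \<subseteq> H \<times> K"
    using T H K by (intro closure_minimal closed_Times) (auto simp: linear_operator_def)
  fix x w w' assume *: "(x, w) \<in> closure T" "(x, w') \<in> closure T"
  have "cinner (w - w') y = 0" if y: "y \<in> Domain (hilbert_adjoint H K T)" for y
  proof -
    obtain z where "(y, z) \<in> hilbert_adjoint H K T" using y by blast
    then have "cinner y w = cinner y w'"
      using * hilbert_adjoint_closure by metis
    then show ?thesis
      using cinner_commute[of "w - w'" y] by (simp add: cinner_diff_right)
  qed
  moreover have "w - w' \<in> K" using sub * csubspace_diff[OF K(1)] by blast
  ultimately have "w - w' = 0"
    using d by (intro dense_orthogonal_eq_zero[of K]) (auto simp: densely_defined_def)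
  then show "w = w'" by simp
qed

text \<open>
  With \<open>S\<close> the adjoint of \<open>T\<close> and \<open>R\<close> the closure of \<open>T\<close>, the operator is \<open>(u, q) \<mapsto> (S q, R u - P q)\<close>.
  Let \<open>(v, r)\<close> be in the domain of its adjoint, with image \<open>(a, b)\<close>. The pairs \<open>(0, q)\<close> of the domain
  show that \<open>(v, b + P r)\<close> is orthogonal to everything that is orthogonal to the graph of \<open>T\<close>, so that
  it belongs to \<open>R\<close>; the pairs \<open>(u, 0)\<close> show that \<open>(r, a)\<close> belongs to \<open>S\<close>. The symmetric term \<open>P\<close> is
  defined everywhere and only moves from one side to the other.
\<close>

lemma self_adjoint_block_operator:
  fixes T :: "('a::{complex_inner, complete_space} \<times> 'b::{complex_inner, complete_space}) set"
  assumes H: "csubspace H" "closed H" and K: "csubspace K" "closed K"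
    and T: "linear_operator H K T" "densely_defined H T"
    and Tadj: "densely_defined K (hilbert_adjoint H K T)"
    and P_in: "\<And>q. q \<in> K \<Longrightarrow> P q \<in> K"
    and P_add: "\<And>q r. q \<in> K \<Longrightarrow> r \<in> K \<Longrightarrow> P (q + r) = P q + P r"
    and P_scale: "\<And>a q. q \<in> K \<Longrightarrow> P (a *\<^sub>C q) = a *\<^sub>C P q"
    and P_sym: "\<And>q r. q \<in> K \<Longrightarrow> r \<in> K \<Longrightarrow> cinner (P q) r = cinner q (P r)"
    and A: "A = {((u, q), (z, w - P q)) | u q z w.
                   (u, w) \<in> closure T \<and> (q, z) \<in> hilbert_adjoint H K T}"
  shows "self_adjoint (H \<times> K) A"
proof -
  let ?S = "hilbert_adjoint H K T"
  have cT: "csubspace (closure T)"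
    using csubspace_closure linear_operator_csubspace T(1) by blast
  have cS: "csubspace ?S" using csubspace_hilbert_adjoint H K by blast
  have T_sub: "closure T \<subseteq> H \<times> K"
    using T(1) H K by (intro closure_minimal closed_Times) (auto simp: linear_operator_def)
  have S_sub: "?S \<subseteq> K \<times> H" by (auto simp: hilbert_adjoint_def)
  have svT: "single_valued (closure T)" using single_valued_closure H K T Tadj by blast
  have svS: "single_valued ?S" using single_valued_hilbert_adjoint H T by blast
  have T0: "(0, 0) \<in> closure T" and S0: "(0, 0) \<in> ?S"
    using csubspace_0[OF cT] csubspace_0[OF cS] by (simp_all add: zero_prod_def)
  have P0: "P 0 = 0" using P_scale[of 0 0] csubspace_0[OF K(1)] by simp
  have "linear_operator (H \<times> K) (H \<times> K) A"
    unfolding linear_operator_def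
  proof (intro conjI)
    show "A \<subseteq> (H \<times> K) \<times> H \<times> K"
      using T_sub S_sub P_in csubspace_diff[OF K(1)] by (force simp: A)
    show "single_valued A"
      using svT svS unfolding single_valued_def A by blast
    show "(0, 0) \<in> A" using T0 S0 P0 by (force simp: A zero_prod_def)
    show "\<forall>(x, y)\<in>A. \<forall>(x', y')\<in>A. (x + x', y + y') \<in> A"
    proof (clarsimp simp: A, goal_cases)
      case (1 u q z w u' q' z' w')
      have "(u + u', w + w') \<in> closure T" "(q + q', z + z') \<in> ?S"
        using csubspace_add[OF cT 1(1) 1(3)] csubspace_add[OF cS 1(2) 1(4)] by simp_all
      moreover have "P (q + q') = P q + P q'" using 1 S_sub P_add by blast
      ultimately show ?case by (intro exI[of _ "w + w'"]) simp
    qed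
    show "\<forall>a. \<forall>(x, y)\<in>A. (a *\<^sub>C x, a *\<^sub>C y) \<in> A"
    proof (clarsimp simp: A scaleC_prod_def, goal_cases)
      case (1 a u q z w)
      have "(a *\<^sub>C u, a *\<^sub>C w) \<in> closure T" "(a *\<^sub>C q, a *\<^sub>C z) \<in> ?S"
        using csubspace_scaleC[OF cT 1(1)] csubspace_scaleC[OF cS 1(2)]
        by (simp_all add: scaleC_prod_def)
      moreover have "P (a *\<^sub>C q) = a *\<^sub>C P q" using 1 S_sub P_scale by blast
      ultimately show ?case by (intro exI[of _ "a *\<^sub>C w"]) (simp add: scaleC_diff_right)
    qed
  qed
  moreover have "densely_defined (H \<times> K) A"
  proof -
    have dom: "Domain A = Domain (closure T) \<times> Domain ?S"
      unfolding A by blast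
    have "Domain T \<subseteq> Domain (closure T)" using closure_subset by blast
    then have "H \<subseteq> closure (Domain (closure T))"
      using T(2) closure_mono unfolding densely_defined_def by blast
    then show ?thesis
      using T_sub S_sub Tadj unfolding densely_defined_def dom closure_Times by auto
  qed
  moreover have "hilbert_adjoint (H \<times> K) (H \<times> K) A = A"
  proof (intro equalityI subsetI)
    fix t assume "t \<in> hilbert_adjoint (H \<times> K) (H \<times> K) A"
    then obtain v r a b where t: "t = ((v, r), (a, b))"
      and in_HK: "v \<in> H" "r \<in> K" "a \<in> H" "b \<in> K"
      and adj: "\<And>u q z w. (u, w) \<in> closure T \<Longrightarrow> (q, z) \<in> ?S \<Longrightarrow>
          cinner v z + cinner r (w - P q) = cinner a u + cinner b q"
      by (cases t) (force simp: hilbert_adjoint_def A cinner_prod_def)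
    have ra: "(r, a) \<in> ?S"
      using adj[OF _ S0] closure_subset[of T] in_HK P0 by (auto simp: hilbert_adjoint_def)
    have Pr: "b + P r \<in> K" using in_HK P_in csubspace_add[OF K(1)] by blast
    have vq: "cinner v z = cinner (b + P r) q" if "(q, z) \<in> ?S" for q z
    proof -
      have "q \<in> K" using that S_sub by blast
      then show ?thesis
        using adj[OF T0 that] in_HK P_sym by (simp add: cinner_minus_right cinner_add_left algebra_simps)
    qed
    have "(v, b + P r) \<in> closure T"
    proof (rule in_closure_if_orthogonal_to_complement[of "H \<times> K"])
      fix g assume g: "g \<in> H \<times> K" "\<And>y. y \<in> T \<Longrightarrow> cinner g y = 0"
      \<comment> \<open>the graph of the adjoint is the rotated orthogonal complement of the graph\<close>
      have "(snd g, - fst g) \<in> ?S"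
        using g csubspace_minus[OF H(1)]
        by (force simp: hilbert_adjoint_def cinner_prod_def cinner_minus_left eq_neg_iff_add_eq_0
            add.commute)
      from vq[OF this] have "cinner v (fst g) + cinner (b + P r) (snd g) = 0"
        by (metis cinner_minus_right add.commute add.right_inverse)
      then show "cinner g (v, b + P r) = 0"
        using cinner_commute[of "fst g" v] cinner_commute[of "snd g" "b + P r"]
        by (simp add: cinner_prod_def flip: complex_cnj_add)
    qed (use H K T in_HK Pr in \<open>auto intro: csubspace_Times closed_Times linear_operator_csubspace
        simp: linear_operator_def\<close>)
    with ra show "t \<in> A" by (force simp: A t)
  next
    fix t assume "t \<in> A"
    then obtain v r a w' where t: "t = ((v, r), (a, w' - P r))"
      and mem: "(v, w') \<in> closure T" "(r, a) \<in> ?S"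
      by (auto simp: A)
    have HK: "v \<in> H" "r \<in> K" "a \<in> H" "w' - P r \<in> K"
      using mem T_sub S_sub P_in csubspace_diff[OF K(1), of w' "P r"] by auto
    have "cinner v z + cinner r (w - P q) = cinner a u + cinner (w' - P r) q"
      if "(u, w) \<in> closure T" "(q, z) \<in> ?S" for u q z w
    proof -
      have "cinner r w = cinner a u" using hilbert_adjoint_closure mem(2) that(1) by blast
      moreover have "cinner q w' = cinner z v" using hilbert_adjoint_closure mem(1) that(2) by blast
      then have "cinner w' q = cinner v z" using cinner_commute by metis
      moreover have "cinner r (P q) = cinner (P r) q" using P_sym HK that S_sub by force
      ultimately show ?thesis by (simp add: cinner_diff_left cinner_diff_right)
    qed
    then show "t \<in> hilbert_adjoint (H \<times> K) (H \<times> K) A"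
      using HK unfolding t by (subst hilbert_adjoint_def) (auto simp: A cinner_prod_def)
  qed
  ultimately show ?thesis unfolding self_adjoint_def by blast
qed

section \<open>The space of square-integrable functions\<close>

lemma square_integrable_rep_L2: "square_integrable (rep_L2 f)"
  using Quotient_rep_reflp[OF Quotient_L2] by blast

lemma abs_rep_L2 [simp]: "abs_L2 (rep_L2 f) = f"
  by (rule Quotient_abs_rep[OF Quotient_L2])

lemma abs_L2_eq_iff:
  assumes "square_integrable f" "square_integrable g"
  shows "abs_L2 f = abs_L2 g \<longleftrightarrow> (AE x in lebesgue. f x = g x)"
  using Quotient_rel[OF Quotient_L2, of f g] assms by auto

lemma L2_cases:
  obtains u where "square_integrable u" "f = abs_L2 u"
  using that square_integrable_rep_L2 abs_rep_L2 by metis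

lemma cinner_abs_L2:
  "square_integrable f \<Longrightarrow> square_integrable g \<Longrightarrow>
    cinner (abs_L2 f) (abs_L2 g) = (LINT x|lebesgue. cnj (f x) * g x)"
  by (rule cinner_L2.abs_eq) auto

lemma add_abs_L2:
  "square_integrable f \<Longrightarrow> square_integrable g \<Longrightarrow> abs_L2 f + abs_L2 g = abs_L2 (\<lambda>x. f x + g x)"
  by (rule plus_L2.abs_eq) auto

lemma diff_abs_L2:
  "square_integrable f \<Longrightarrow> square_integrable g \<Longrightarrow> abs_L2 f - abs_L2 g = abs_L2 (\<lambda>x. f x - g x)"
  by (rule minus_L2.abs_eq) auto

lemma scaleC_abs_L2: "square_integrable f \<Longrightarrow> a *\<^sub>C abs_L2 f = abs_L2 (\<lambda>x. a * f x)"
  by (rule scaleC_L2.abs_eq) auto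

lemma zero_abs_L2: "0 = abs_L2 (\<lambda>x. 0)"
  unfolding zero_L2_def ..

lemma norm_abs_L2:
  assumes "square_integrable f"
  shows "ennreal ((norm (abs_L2 f))\<^sup>2) = (\<integral>\<^sup>+x. ennreal ((cmod (f x))\<^sup>2) \<partial>lebesgue)"
proof -
  have "cinner (abs_L2 f) (abs_L2 f) = (LINT x|lebesgue. complex_of_real ((cmod (f x))\<^sup>2))"
    unfolding cinner_abs_L2[OF assms assms]
    by (intro Bochner_Integration.integral_cong refl) (simp only: complex_norm_square mult.commute)
  also have "\<dots> = complex_of_real (LINT x|lebesgue. (cmod (f x))\<^sup>2)"
    by (rule integral_complex_of_real)
  finally have "(norm (abs_L2 f))\<^sup>2 = (LINT x|lebesgue. (cmod (f x))\<^sup>2)"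
    by (simp add: power2_norm_eq_inner inner_eq_Re_cinner)
  then show ?thesis
    using assms by (simp add: square_integrable_def nn_integral_eq_integral)
qed

lemma square_integrableI_nn_integral:
  assumes "f \<in> borel_measurable lebesgue" "(\<integral>\<^sup>+x. ennreal ((cmod (f x))\<^sup>2) \<partial>lebesgue) < \<infinity>"
  shows "square_integrable f"
  using assms unfolding square_integrable_def by (simp add: integrable_iff_bounded)

text \<open>
  The Riesz--Fischer argument for a sequence with geometrically decreasing differences \<open>d\<^sub>k\<close>:
  the weighted sum of the squares \<open>2^k |d\<^sub>k|\<^sup>2\<close> has a finite integral, hence is finite almost
  everywhere, so that there \<open>|d\<^sub>k|\<close> is dominated by a geometric sequence. The norms decrease like
  \<open>2^(-k)\<close>, so their squares leave room for the weights.
\<close>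

lemma AE_convergent_if_geometric_L2:
  fixes f :: "nat \<Rightarrow> 'a::euclidean_space \<Rightarrow> complex"
  assumes f: "\<And>k. square_integrable (f k)"
    and d: "\<And>k. norm (abs_L2 (f (Suc k)) - abs_L2 (f k)) \<le> (1/2) ^ k"
  shows "AE x in lebesgue. convergent (\<lambda>k. f k x)"
proof -
  define D where "D = (\<lambda>k x. f (Suc k) x - f k x)"
  have D: "square_integrable (D k)" for k
    unfolding D_def using f by (intro square_integrable_diff)
  have [measurable]: "D k \<in> borel_measurable lebesgue" for k
    using D[of k] by (simp add: square_integrable_def)
  let ?s = "\<lambda>x. \<Sum>k. ennreal (2 ^ k * (cmod (D k x))\<^sup>2)"
  have "(\<integral>\<^sup>+x. ennreal (2 ^ k * (cmod (D k x))\<^sup>2) \<partial>lebesgue) \<le> ennreal ((1/2) ^ k)" for k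
  proof -
    have "(\<integral>\<^sup>+x. ennreal (2 ^ k * (cmod (D k x))\<^sup>2) \<partial>lebesgue)
        = ennreal (2 ^ k) * ennreal ((norm (abs_L2 (D k)))\<^sup>2)"
      unfolding norm_abs_L2[OF D] by (simp add: ennreal_mult nn_integral_cmult)
    also have "\<dots> \<le> ennreal (2 ^ k) * ennreal (((1/2) ^ k)\<^sup>2)"
      using d[of k] f by (intro mult_left_mono ennreal_leI power_mono) (auto simp: D_def diff_abs_L2)
    also have "\<dots> = ennreal ((1/2) ^ k)"
      by (simp add: ennreal_mult[symmetric] power2_eq_square power_divide)
    finally show ?thesis .
  qed
  then have "(\<integral>\<^sup>+x. ?s x \<partial>lebesgue) \<le> (\<Sum>k. ennreal ((1/2) ^ k))"
    by (subst nn_integral_suminf) (auto intro!: suminf_le)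
  also have "\<dots> < \<infinity>"
    by (subst suminf_ennreal2) (auto intro!: summable_geometric)
  finally have "AE x in lebesgue. ?s x \<noteq> \<infinity>"
    by (intro nn_integral_PInf_AE) auto
  then show ?thesis
  proof eventually_elim
    fix x assume fin: "?s x \<noteq> \<infinity>"
    define C where "C = enn2real (?s x)"
    have C_eq: "?s x = ennreal C" unfolding C_def using fin by (simp add: less_top[symmetric])
    have C0: "0 \<le> C" unfolding C_def by (rule enn2real_nonneg)
    have C: "2 ^ k * (cmod (D k x))\<^sup>2 \<le> C" for k
    proof -
      have "ennreal (2 ^ k * (cmod (D k x))\<^sup>2) \<le> ?s x"
        by (rule order_trans[OF _ sum_le_suminf[of _ "{k}"]]) (auto intro: summableI)
      then have "ennreal (2 ^ k * (cmod (D k x))\<^sup>2) \<le> ennreal C" unfolding C_eq .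
      then show ?thesis by (rule ennreal_le_iff[OF C0, THEN iffD1])
    qed
    have D_le: "cmod (D k x) \<le> sqrt C * (1 / sqrt 2) ^ k" for k
    proof (rule power2_le_imp_le)
      show "(cmod (D k x))\<^sup>2 \<le> (sqrt C * (1 / sqrt 2) ^ k)\<^sup>2"
      proof -
        have "((1 / sqrt 2) ^ k)\<^sup>2 = ((1 / sqrt 2)\<^sup>2) ^ k"
          by (metis power_mult mult.commute)
        moreover have "(1 / sqrt 2)\<^sup>2 = 1 / (2::real)" by (simp add: power_divide)
        ultimately have "(sqrt C * (1 / sqrt 2) ^ k)\<^sup>2 = C * (1 / 2) ^ k"
          using C0 by (simp only: power_mult_distrib real_sqrt_pow2)
        also have "\<dots> = C / 2 ^ k" by (simp add: power_divide)
        finally show ?thesis using C[of k] by (simp add: pos_le_divide_eq mult.commute)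
      qed
      show "0 \<le> sqrt C * (1 / sqrt 2) ^ k" using C0 by simp
    qed
    have "summable (\<lambda>k. sqrt C * (1 / sqrt 2) ^ k)"
      by (intro summable_mult summable_geometric) simp
    then have "summable (\<lambda>k. D k x)"
      by (rule summable_comparison_test'[where N = 0]) (rule D_le)
    then have "convergent (\<lambda>n. \<Sum>k<n. D k x)"
      unfolding summable_iff_convergent .
    then have "convergent (\<lambda>n. f 0 x + (f n x - f 0 x))"
      unfolding D_def sum_lessThan_telescope[of "\<lambda>k. f k x"]
      by (intro convergent_add convergent_const)
    then show "convergent (\<lambda>n. f n x)" by simp
  qed
qed

text \<open>
  The limit is the pointwise one. Fatou's lemma carries the bound on the distance between two terms
  over to the distance from a term to this limit.
\<close>

lemma geometric_L2_converges:
  fixes f :: "nat \<Rightarrow> 'a::euclidean_space L2"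
  assumes d: "\<And>k n. k \<le> n \<Longrightarrow> norm (f n - f k) \<le> (1/2) ^ k"
  shows "\<exists>g. f \<longlonglongrightarrow> g"
proof -
  let ?u = "\<lambda>k. rep_L2 (f k)"
  define g where "g = (\<lambda>x. lim (\<lambda>k. ?u k x))"
  have u: "square_integrable (?u k)" for k by (rule square_integrable_rep_L2)
  have [measurable]: "?u k \<in> borel_measurable lebesgue" for k
    using u[of k] by (simp add: square_integrable_def)
  have [measurable]: "g \<in> borel_measurable lebesgue"
    unfolding g_def by (rule borel_measurable_lim_metric) measurable
  have conv: "AE x in lebesgue. (\<lambda>k. ?u k x) \<longlonglongrightarrow> g x"
    using AE_convergent_if_geometric_L2[of ?u, OF u] d[of k "Suc k" for k]
    by (simp add: g_def convergent_LIMSEQ_iff)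
  have bound: "(\<integral>\<^sup>+x. ennreal ((cmod (g x - ?u k x))\<^sup>2) \<partial>lebesgue) \<le> ennreal (((1/2) ^ k)\<^sup>2)" for k
  proof -
    have "(\<integral>\<^sup>+x. ennreal ((cmod (g x - ?u k x))\<^sup>2) \<partial>lebesgue)
        = (\<integral>\<^sup>+x. liminf (\<lambda>n. ennreal ((cmod (?u n x - ?u k x))\<^sup>2)) \<partial>lebesgue)"
    proof (rule nn_integral_cong_AE)
      show "AE x in lebesgue. ennreal ((cmod (g x - ?u k x))\<^sup>2)
          = liminf (\<lambda>n. ennreal ((cmod (?u n x - ?u k x))\<^sup>2))"
        using conv
      proof eventually_elim
        fix x assume "(\<lambda>n. ?u n x) \<longlonglongrightarrow> g x"
        then have "(\<lambda>n. ennreal ((cmod (?u n x - ?u k x))\<^sup>2)) \<longlonglongrightarrow> ennreal ((cmod (g x - ?u k x))\<^sup>2)"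
          by (intro tendsto_intros)
        then show "ennreal ((cmod (g x - ?u k x))\<^sup>2)
            = liminf (\<lambda>n. ennreal ((cmod (?u n x - ?u k x))\<^sup>2))"
          using lim_imp_Liminf[OF sequentially_bot] by metis
      qed
    qed
    also have "\<dots> \<le> liminf (\<lambda>n. \<integral>\<^sup>+x. ennreal ((cmod (?u n x - ?u k x))\<^sup>2) \<partial>lebesgue)"
      by (intro nn_integral_liminf) measurable
    also have "\<dots> = liminf (\<lambda>n. ennreal ((norm (f n - f k))\<^sup>2))"
    proof -
      have "(\<integral>\<^sup>+x. ennreal ((cmod (?u n x - ?u k x))\<^sup>2) \<partial>lebesgue) = ennreal ((norm (f n - f k))\<^sup>2)"
        for n
        using norm_abs_L2[OF square_integrable_diff[OF u u], of n k] diff_abs_L2[OF u u, of n k]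
        by simp
      then show ?thesis by simp
    qed
    also have "\<dots> \<le> ennreal (((1/2) ^ k)\<^sup>2)"
    proof (rule Liminf_le)
      show "eventually (\<lambda>n. ennreal ((norm (f n - f k))\<^sup>2) \<le> ennreal (((1/2) ^ k)\<^sup>2)) sequentially"
        using eventually_ge_at_top[of k]
        by eventually_elim (intro ennreal_leI power_mono d, auto)
    qed simp
    finally show ?thesis .
  qed
  have gu: "square_integrable (\<lambda>x. g x - ?u k x)" for k
    using bound[of k] by (intro square_integrableI_nn_integral) (auto simp: top.not_eq_extremum[symmetric] top_unique)
  have g: "square_integrable g"
    using square_integrable_add[OF gu[of 0] u[of 0]] by simp
  have "norm (f k - abs_L2 g) \<le> (1/2) ^ k" for k
  proof -
    have "ennreal ((norm (abs_L2 g - f k))\<^sup>2) \<le> ennreal (((1/2) ^ k)\<^sup>2)"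
      using bound[of k] norm_abs_L2[OF gu] diff_abs_L2[OF g u[of k]] by simp
    then show ?thesis
      by (subst norm_minus_commute) (auto simp: ennreal_le_iff intro: power2_le_imp_le)
  qed
  then have "(\<lambda>k. norm (f k - abs_L2 g)) \<longlonglongrightarrow> 0"
    by (intro tendsto_sandwich[OF _ _ tendsto_const LIMSEQ_power_zero[of "1/2::real"]]) auto
  then show ?thesis by (auto simp: LIM_zero_iff tendsto_norm_zero_iff)
qed

instance L2 :: (euclidean_space) complete_space
proof
  fix X :: "nat \<Rightarrow> 'a L2" assume X: "Cauchy X"
  have "\<exists>N. \<forall>m\<ge>N. \<forall>n\<ge>N. dist (X m) (X n) < (1/2) ^ k" for k
    using X by (auto simp: Cauchy_def)
  then obtain N where N: "\<And>k m n. m \<ge> N k \<Longrightarrow> n \<ge> N k \<Longrightarrow> dist (X m) (X n) < (1/2) ^ k"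
    by metis
  define r where "r k = k + (\<Sum>i\<le>k. N i)" for k
  have r: "strict_mono r" by (simp add: strict_mono_Suc_iff r_def)
  have rN: "N k \<le> r k" for k
    using member_le_sum[of k "{..k}" N] by (simp add: r_def)
  have "norm (X (r n) - X (r k)) \<le> (1/2) ^ k" if "k \<le> n" for k n
  proof -
    have "r k \<le> r n" using r that by (simp add: strict_mono_less_eq)
    then show ?thesis using N[of k "r n" "r k"] rN[of k] by (simp add: dist_norm)
  qed
  then obtain g where "(X \<circ> r) \<longlonglongrightarrow> g"
    using geometric_L2_converges[of "X \<circ> r"] by auto
  then show "convergent X"
    using Cauchy_converges_subseq[OF X r] by (auto simp: convergent_def)
qed

lemma abs_L2_in_L2_on:
  "square_integrable f \<Longrightarrow> abs_L2 f \<in> L2_on \<Omega> \<longleftrightarrow> (AE x in lebesgue. x \<notin> \<Omega> \<longrightarrow> f x = 0)"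
  unfolding L2_on_def mem_Collect_eq by (rule vanishes_off.abs_eq) auto

lemma csubspace_L2_on: "csubspace (L2_on \<Omega>)"
  unfolding csubspace_def
proof (intro conjI ballI allI)
  show "0 \<in> L2_on \<Omega>" by (simp add: zero_abs_L2 abs_L2_in_L2_on square_integrable_zero)
  fix f g assume "f \<in> L2_on \<Omega>" "g \<in> L2_on \<Omega>"
  then show "f + g \<in> L2_on \<Omega>"
  proof (cases f rule: L2_cases; cases g rule: L2_cases)
    fix u v assume *: "square_integrable u" "f = abs_L2 u" "square_integrable v" "g = abs_L2 v"
      "f \<in> L2_on \<Omega>" "g \<in> L2_on \<Omega>"
    then have "AE x in lebesgue. x \<notin> \<Omega> \<longrightarrow> u x = 0" "AE x in lebesgue. x \<notin> \<Omega> \<longrightarrow> v x = 0"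
      by (auto simp: abs_L2_in_L2_on)
    then have "AE x in lebesgue. x \<notin> \<Omega> \<longrightarrow> u x + v x = 0" by eventually_elim simp
    then show ?thesis using * by (simp add: add_abs_L2 abs_L2_in_L2_on square_integrable_add)
  qed
  show "a *\<^sub>C f \<in> L2_on \<Omega>" for a
  proof (cases f rule: L2_cases)
    case (1 u)
    then have "AE x in lebesgue. x \<notin> \<Omega> \<longrightarrow> u x = 0"
      using \<open>f \<in> L2_on \<Omega>\<close> by (auto simp: abs_L2_in_L2_on)
    then have "AE x in lebesgue. x \<notin> \<Omega> \<longrightarrow> a * u x = 0" by eventually_elim simp
    then show ?thesis using 1 by (simp add: scaleC_abs_L2 abs_L2_in_L2_on square_integrable_scale)
  qed
qed

text \<open>
  The subspace is the orthogonal complement of the functions that live outside \<open>\<Omega>\<close>; therefore it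
  is closed.
\<close>

lemma closed_L2_on:
  assumes "\<Omega> \<in> sets lebesgue"
  shows "closed (L2_on \<Omega> :: 'a::euclidean_space L2 set)"
proof -
  have orth: "cinner g f = 0" if "f \<in> L2_on \<Omega>" "g \<in> L2_on (- \<Omega>)" for f g
  proof (cases f rule: L2_cases; cases g rule: L2_cases)
    fix u v assume *: "square_integrable u" "f = abs_L2 u" "square_integrable v" "g = abs_L2 v"
    then have "AE x in lebesgue. x \<notin> \<Omega> \<longrightarrow> u x = 0" "AE x in lebesgue. x \<notin> - \<Omega> \<longrightarrow> v x = 0"
      using that by (auto simp: abs_L2_in_L2_on)
    then have "AE x in lebesgue. cnj (v x) * u x = 0"
      by eventually_elim auto
    then show ?thesis using * by (simp add: cinner_abs_L2 integral_eq_zero_AE)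
  qed
  have "f \<in> L2_on \<Omega>" if f: "\<And>g. g \<in> L2_on (- \<Omega>) \<Longrightarrow> cinner g f = 0" for f
  proof (cases f rule: L2_cases)
    case (1 u)
    let ?v = "\<lambda>x. if x \<in> \<Omega> then 0 else u x" and ?w = "\<lambda>x. if x \<in> \<Omega> then u x else 0"
    have [measurable]: "u \<in> borel_measurable lebesgue" "Measurable.pred lebesgue (\<lambda>x. x \<in> \<Omega>)"
      using 1 assms by (auto simp: square_integrable_def pred_def)
    have "integrable lebesgue (\<lambda>x. (cmod (u x))\<^sup>2)" using 1 by (simp add: square_integrable_def)
    then have "integrable lebesgue (\<lambda>x. (cmod (?v x))\<^sup>2)" "integrable lebesgue (\<lambda>x. (cmod (?w x))\<^sup>2)"
      by (rule Bochner_Integration.integrable_bound; measurable; simp)+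
    then have vw: "square_integrable ?v" "square_integrable ?w"
      by (simp_all add: square_integrable_def)
    have "cinner (abs_L2 ?v) f = 0"
      using vw by (intro f) (auto simp: abs_L2_in_L2_on)
    moreover have "cinner (abs_L2 ?v) (abs_L2 ?w) = 0"
      using vw by (auto simp: cinner_abs_L2 intro!: integral_eq_zero_AE AE_I2)
    moreover have split: "f = abs_L2 ?v + abs_L2 ?w"
      using vw 1 by (auto simp: add_abs_L2 intro!: arg_cong[of _ _ abs_L2])
    ultimately have "abs_L2 ?v = 0"
      by (simp add: cinner_add_right cinner_self_eq_zero)
    then have "f = abs_L2 ?w" using split by simp
    then show ?thesis using vw by (simp add: abs_L2_in_L2_on)
  qed
  with orth have "L2_on \<Omega> = (\<Inter>g\<in>L2_on (- \<Omega>). {f. cinner g f = 0})" by blast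
  moreover have "closed {f. cinner g f = 0}" for g :: "'a L2"
  proof -
    have "continuous_on UNIV (\<lambda>f. cinner g f)"
      unfolding continuous_on_def by (intro ballI tendsto_cinner tendsto_intros)
    then show ?thesis using continuous_closed_vimage[of "{0}" "cinner g"]
      by (simp add: vimage_def continuous_on_eq_continuous_at)
  qed
  ultimately show ?thesis by auto
qed

lemma csubspace_L2_vec_on: "csubspace (L2_vec_on \<Omega>)"
  unfolding csubspace_def L2_vec_on_def
  by (auto simp: scaleC_vec_def intro: csubspaceD[OF csubspace_L2_on])

lemma closed_L2_vec_on:
  fixes \<Omega> :: "(real^'n) set"
  assumes "\<Omega> \<in> sets lebesgue"
  shows "closed (L2_vec_on \<Omega>)"
proof -
  have "closed (\<Inter>k. (\<lambda>q :: (real^'n) L2 ^ 'n. q $ k) -` L2_on \<Omega>)"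
    by (intro closed_INT ballI continuous_closed_vimage closed_L2_on assms continuous_intros)
  moreover have "L2_vec_on \<Omega> = (\<Inter>k. (\<lambda>q. q $ k) -` L2_on \<Omega>)"
    by (auto simp: L2_vec_on_def)
  ultimately show ?thesis by simp
qed

section \<open>Multiplication by a bounded real function\<close>

lemma square_integrable_mult_on:
  assumes \<Omega>: "\<Omega> \<in> sets lebesgue" and p: "p \<in> Linfty_on \<Omega>" and u: "square_integrable u"
  shows "square_integrable (\<lambda>x. if x \<in> \<Omega> then complex_of_real (p x) * u x else 0)"
proof -
  obtain C where C: "AE x in lebesgue_on \<Omega>. \<bar>p x\<bar> \<le> C"
    and [measurable]: "p \<in> borel_measurable (lebesgue_on \<Omega>)"
    using p by (auto simp: Linfty_on_def)
  have [measurable]: "u \<in> borel_measurable lebesgue" "u \<in> borel_measurable (lebesgue_on \<Omega>)"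
    using u by (auto simp: square_integrable_def intro: measurable_restrict_space1)
  let ?v = "\<lambda>x. if x \<in> \<Omega> then complex_of_real (p x) * u x else 0"
  have [measurable]: "?v \<in> borel_measurable lebesgue"
    using \<Omega> by (intro borel_measurable_if_I) measurable
  have "AE x in lebesgue. x \<in> \<Omega> \<longrightarrow> \<bar>p x\<bar> \<le> C"
    using C \<Omega> by (simp add: AE_restrict_space_iff)
  then have bound: "AE x in lebesgue. norm ((cmod (?v x))\<^sup>2) \<le> norm (C\<^sup>2 * (cmod (u x))\<^sup>2)"
  proof eventually_elim
    fix x assume *: "x \<in> \<Omega> \<longrightarrow> \<bar>p x\<bar> \<le> C"
    have "x \<in> \<Omega> \<Longrightarrow> \<bar>p x\<bar>\<^sup>2 \<le> C\<^sup>2" using * by (intro power_mono) auto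
    then show "norm ((cmod (?v x))\<^sup>2) \<le> norm (C\<^sup>2 * (cmod (u x))\<^sup>2)"
      by (auto simp: norm_mult power_mult_distrib intro: mult_right_mono)
  qed
  have "integrable lebesgue (\<lambda>x. C\<^sup>2 * (cmod (u x))\<^sup>2)"
    using u by (simp add: square_integrable_def)
  then have "integrable lebesgue (\<lambda>x. (cmod (?v x))\<^sup>2)"
    by (rule Bochner_Integration.integrable_bound[OF _ _ bound]) measurable
  then show ?thesis by (simp add: square_integrable_def)
qed

lemma mult_on_abs_L2:
  assumes "\<Omega> \<in> sets lebesgue" "p \<in> Linfty_on \<Omega>" "square_integrable u"
  shows "mult_on \<Omega> p (abs_L2 u) = abs_L2 (\<lambda>x. if x \<in> \<Omega> then complex_of_real (p x) * u x else 0)"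
proof -
  have "AE x in lebesgue. rep_L2 (abs_L2 u) x = u x"
    using abs_L2_eq_iff[OF square_integrable_rep_L2 assms(3), of "abs_L2 u"] by simp
  then have "AE x in lebesgue. (if x \<in> \<Omega> then complex_of_real (p x) * rep_L2 (abs_L2 u) x else 0)
      = (if x \<in> \<Omega> then complex_of_real (p x) * u x else 0)"
    by eventually_elim simp
  then show ?thesis
    unfolding mult_on_def using assms
    by (simp add: abs_L2_eq_iff square_integrable_mult_on square_integrable_rep_L2)
qed

lemma
  assumes \<Omega>: "\<Omega> \<in> sets lebesgue" and p: "p \<in> Linfty_on \<Omega>"
  shows mult_on_in_L2_on: "mult_on \<Omega> p f \<in> L2_on \<Omega>"
    and mult_on_add: "mult_on \<Omega> p (f + g) = mult_on \<Omega> p f + mult_on \<Omega> p g"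
    and mult_on_scaleC: "mult_on \<Omega> p (a *\<^sub>C f) = a *\<^sub>C mult_on \<Omega> p f"
    and mult_on_symmetric: "cinner (mult_on \<Omega> p f) g = cinner f (mult_on \<Omega> p g)"
proof -
  obtain u v where u: "square_integrable u" "f = abs_L2 u" and v: "square_integrable v" "g = abs_L2 v"
    using L2_cases by metis
  note rules = mult_on_abs_L2[OF \<Omega> p] square_integrable_mult_on[OF \<Omega> p] u v abs_L2_in_L2_on
    add_abs_L2 scaleC_abs_L2 cinner_abs_L2 square_integrable_add square_integrable_scale
  show "mult_on \<Omega> p f \<in> L2_on \<Omega>" by (simp add: rules)
  show "mult_on \<Omega> p (f + g) = mult_on \<Omega> p f + mult_on \<Omega> p g"
    by (auto simp: rules algebra_simps intro!: arg_cong[of _ _ abs_L2])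
  show "mult_on \<Omega> p (a *\<^sub>C f) = a *\<^sub>C mult_on \<Omega> p f"
    by (auto simp: rules algebra_simps intro!: arg_cong[of _ _ abs_L2])
  show "cinner (mult_on \<Omega> p f) g = cinner f (mult_on \<Omega> p g)"
    by (auto simp: rules intro!: Bochner_Integration.integral_cong)
qed

section \<open>Calculus of test functions\<close>

lemma partial_deriv_eqI:
  "((\<lambda>t. f (x + t *\<^sub>R axis k 1)) has_vector_derivative D) (at 0) \<Longrightarrow> partial_deriv k f x = D"
  unfolding partial_deriv_def by (rule vector_derivative_at)

lemma has_vector_derivative_partial_deriv:
  fixes f :: "real^'n \<Rightarrow> complex"
  assumes "f differentiable (at (x + s *\<^sub>R axis k 1))"
  shows "((\<lambda>t. f (x + t *\<^sub>R axis k 1)) has_vector_derivative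
           partial_deriv k f (x + s *\<^sub>R axis k 1)) (at s)"
proof -
  let ?e = "axis k 1 :: real^'n"
  have shifted: "((\<lambda>t. f (y + t *\<^sub>R ?e)) has_vector_derivative partial_deriv k f y) (at 0)"
    if "f differentiable (at y)" for y
  proof -
    have "(f \<circ> (\<lambda>t. y + t *\<^sub>R ?e)) differentiable (at 0)"
      using that by (intro differentiable_chain_at derivative_intros) simp_all
    then show ?thesis
      unfolding partial_deriv_def by (simp add: vector_derivative_works o_def)
  qed
  have "((\<lambda>t. f ((x + s *\<^sub>R ?e) + t *\<^sub>R ?e)) \<circ> (\<lambda>t. t - s) has_vector_derivative
      1 *\<^sub>R partial_deriv k f (x + s *\<^sub>R ?e)) (at s)"
    using shifted[OF assms]
    by (intro vector_diff_chain_at derivative_eq_intros) (auto intro!: derivative_eq_intros)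
  then show ?thesis by (simp add: o_def algebra_simps)
qed

lemma has_vector_derivative_partial_deriv_0:
  fixes f :: "real^'n \<Rightarrow> complex"
  assumes "f differentiable (at x)"
  shows "((\<lambda>t. f (x + t *\<^sub>R axis k 1)) has_vector_derivative partial_deriv k f x) (at 0)"
  using has_vector_derivative_partial_deriv[of f x 0 k] assms by simp

lemma partial_deriv_const: "partial_deriv k (\<lambda>x. c) = (\<lambda>x. 0)"
  by (intro ext partial_deriv_eqI) simp

lemma partial_deriv_add:
  assumes "f differentiable (at x)" "g differentiable (at x)"
  shows "partial_deriv k (\<lambda>x. f x + g x) x = partial_deriv k f x + partial_deriv k g x"
  by (intro partial_deriv_eqI has_vector_derivative_add has_vector_derivative_partial_deriv_0 assms)

lemma partial_deriv_mult:
  assumes "f differentiable (at x)" "g differentiable (at x)"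
  shows "partial_deriv k (\<lambda>x. f x * g x) x = f x * partial_deriv k g x + partial_deriv k f x * g x"
  using has_vector_derivative_mult[OF has_vector_derivative_partial_deriv_0[OF assms(1), of k]
      has_vector_derivative_partial_deriv_0[OF assms(2), of k]]
  by (intro partial_deriv_eqI) simp

lemma partial_deriv_cnj:
  assumes "f differentiable (at x)"
  shows "partial_deriv k (\<lambda>x. cnj (f x)) x = cnj (partial_deriv k f x)"
  by (intro partial_deriv_eqI has_vector_derivative_cnj has_vector_derivative_partial_deriv_0 assms)

lemma C_diff_lower: "C_diff (Suc m) f \<Longrightarrow> C_diff m f"
proof (induction m arbitrary: f)
  case 0
  then show ?case
    by (auto simp: continuous_on_eq_continuous_at intro: differentiable_imp_continuous_within)
next
  case (Suc m)
  then show ?case by (metis C_diff.simps(2))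
qed

lemma C_diff_const: "C_diff m (\<lambda>x. c)"
  by (induction m arbitrary: c) (auto simp: partial_deriv_const)

lemma C_diff_add:
  "C_diff m f \<Longrightarrow> C_diff m g \<Longrightarrow> C_diff m (\<lambda>x. f x + g x)"
proof (induction m arbitrary: f g)
  case (Suc m)
  then have "partial_deriv k (\<lambda>x. f x + g x) = (\<lambda>x. partial_deriv k f x + partial_deriv k g x)" for k
    by (intro ext partial_deriv_add) auto
  with Suc show ?case by (auto intro: differentiable_add)
qed (auto intro: continuous_intros)

lemma C_diff_mult:
  "C_diff m f \<Longrightarrow> C_diff m g \<Longrightarrow> C_diff m (\<lambda>x. f x * g x)"
proof (induction m arbitrary: f g)
  case (Suc m)
  then have "partial_deriv k (\<lambda>x. f x * g x)
      = (\<lambda>x. f x * partial_deriv k g x + partial_deriv k f x * g x)" for k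
    by (intro ext partial_deriv_mult) auto
  moreover have "C_diff m f" "C_diff m g" using Suc.prems by (auto intro: C_diff_lower)
  then have "C_diff m (\<lambda>x. f x * partial_deriv k g x + partial_deriv k f x * g x)" for k
    using Suc.prems by (intro C_diff_add Suc.IH) auto
  ultimately show ?case using Suc.prems by (auto intro: differentiable_mult)
qed (auto intro: continuous_intros)

lemma C_diff_prod:
  "(\<And>i. i \<in> I \<Longrightarrow> C_diff m (f i)) \<Longrightarrow> C_diff m (\<lambda>x. \<Prod>i\<in>I. f i x)"
  by (induction I rule: infinite_finite_induct) (auto simp: C_diff_const intro: C_diff_mult)

lemma partial_deriv_outside_support:
  assumes "x \<notin> closure {x. f x \<noteq> 0}"
  shows "partial_deriv k f x = 0"
proof (rule partial_deriv_eqI)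
  let ?S = "(\<lambda>t. x + t *\<^sub>R axis k 1) -` (- closure {x. f x \<noteq> 0})"
  have "open ?S" by (intro continuous_open_vimage continuous_intros) auto
  moreover have "0 \<in> ?S" using assms by simp
  moreover have "0 = f (x + t *\<^sub>R axis k 1)" if "t \<in> ?S" for t
    using that closure_subset[of "{x. f x \<noteq> 0}"] by auto
  ultimately show "((\<lambda>t. f (x + t *\<^sub>R axis k 1)) has_vector_derivative 0) (at 0)"
    by (rule has_vector_derivative_transform_within_open[OF has_vector_derivative_const])
qed

lemma test_funI:
  assumes "\<And>m. C_diff m f" "compact K" "K \<subseteq> \<Omega>" "\<And>x. x \<notin> K \<Longrightarrow> f x = 0"
  shows "f \<in> test_fun \<Omega>"
proof -
  have "closure {x. f x \<noteq> 0} \<subseteq> K"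
    using assms by (intro closure_minimal compact_imp_closed) auto
  moreover from this have "compact (closure {x. f x \<noteq> 0})"
    using compact_Int_closed[OF assms(2) closed_closure, of "{x. f x \<noteq> 0}"]
    by (simp only: Int_absorb1)
  ultimately show ?thesis using assms by (auto simp: test_fun_def)
qed

lemma test_funE:
  assumes "f \<in> test_fun \<Omega>"
  obtains K where "compact K" "K \<subseteq> \<Omega>" "\<And>x. x \<notin> K \<Longrightarrow> f x = 0"
    "\<And>k x. x \<notin> K \<Longrightarrow> partial_deriv k f x = 0"
proof (rule that[of "closure {x. f x \<noteq> 0}"])
  show "f x = 0" if "x \<notin> closure {x. f x \<noteq> 0}" for x
    using that closure_subset[of "{x. f x \<noteq> 0}"] by auto
qed (use assms in \<open>auto simp: test_fun_def partial_deriv_outside_support\<close>)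

lemma
  assumes "f \<in> test_fun \<Omega>"
  shows test_fun_C_diff: "C_diff m f"
    and test_fun_differentiable: "f differentiable (at x)"
    and test_fun_continuous: "continuous_on UNIV f"
    and test_fun_continuous_partial_deriv: "continuous_on UNIV (partial_deriv k f)"
proof -
  have C: "C_diff m f" for m using assms by (simp add: test_fun_def)
  then show "C_diff m f" .
  show "f differentiable (at x)" "continuous_on UNIV f" using C[of "Suc 0"] C[of 0] by simp_all
  show "continuous_on UNIV (partial_deriv k f)" using C[of "Suc 0"] by simp
qed

lemma test_fun_zero: "(\<lambda>x. 0) \<in> test_fun \<Omega>"
  by (rule test_funI[of _ "{}"]) (auto simp: C_diff_const)

lemma test_fun_add:
  assumes "f \<in> test_fun \<Omega>" "g \<in> test_fun \<Omega>"
  shows "(\<lambda>x. f x + g x) \<in> test_fun \<Omega>"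
proof -
  obtain K where K: "compact K" "K \<subseteq> \<Omega>" "\<And>x. x \<notin> K \<Longrightarrow> f x = 0" using assms(1) by (rule test_funE) blast
  obtain L where L: "compact L" "L \<subseteq> \<Omega>" "\<And>x. x \<notin> L \<Longrightarrow> g x = 0" using assms(2) by (rule test_funE) blast
  have "C_diff m (\<lambda>x. f x + g x)" for m
    using assms by (intro C_diff_add test_fun_C_diff)
  then show ?thesis
    by (rule test_funI[of _ "K \<union> L"]) (use K L in auto)
qed

lemma test_fun_scale:
  assumes "f \<in> test_fun \<Omega>"
  shows "(\<lambda>x. a * f x) \<in> test_fun \<Omega>"
proof -
  obtain K where K: "compact K" "K \<subseteq> \<Omega>" "\<And>x. x \<notin> K \<Longrightarrow> f x = 0"
    using assms by (rule test_funE) blast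
  have "C_diff m (\<lambda>x. a * f x)" for m
    using assms by (intro C_diff_mult C_diff_const test_fun_C_diff)
  then show ?thesis by (rule test_funI[of _ K]) (use K in auto)
qed

lemma test_fun_partial_deriv:
  assumes "f \<in> test_fun \<Omega>"
  shows "partial_deriv k f \<in> test_fun \<Omega>"
proof -
  obtain K where "compact K" "K \<subseteq> \<Omega>" "\<And>x. x \<notin> K \<Longrightarrow> partial_deriv k f x = 0"
    using assms by (rule test_funE) blast
  moreover have "C_diff m (partial_deriv k f)" for m
    using test_fun_C_diff[OF assms, of "Suc m"] by simp
  ultimately show ?thesis by (intro test_funI[of _ K])
qed

lemma partial_deriv_add_test_fun:
  "f \<in> test_fun \<Omega> \<Longrightarrow> g \<in> test_fun \<Omega> \<Longrightarrow>
    partial_deriv k (\<lambda>x. f x + g x) = (\<lambda>x. partial_deriv k f x + partial_deriv k g x)"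
  by (intro ext partial_deriv_add test_fun_differentiable)

lemma partial_deriv_scale_test_fun:
  "f \<in> test_fun \<Omega> \<Longrightarrow> partial_deriv k (\<lambda>x. a * f x) = (\<lambda>x. a * partial_deriv k f x)"
  by (intro ext, subst partial_deriv_mult) (auto intro: test_fun_differentiable simp: partial_deriv_const)

lemma integrable_lborel_compact_support:
  fixes f :: "'a::euclidean_space \<Rightarrow> 'b::{banach, second_countable_topology}"
  assumes "continuous_on UNIV f" "compact K" "\<And>x. x \<notin> K \<Longrightarrow> f x = 0"
  shows "integrable lborel f"
proof -
  have "integrable lborel (\<lambda>x. indicator K x *\<^sub>R f x)"
    using assms by (intro borel_integrable_compact) (auto intro: continuous_on_subset)
  moreover have "(\<lambda>x. indicator K x *\<^sub>R f x) = f"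
    using assms(3) by (auto simp: indicator_def)
  ultimately show ?thesis by simp
qed

lemma square_integrable_test_fun:
  assumes "f \<in> test_fun \<Omega>"
  shows "square_integrable f"
proof -
  obtain K where K: "compact K" "\<And>x. x \<notin> K \<Longrightarrow> f x = 0" using assms by (rule test_funE) blast
  have c: "continuous_on UNIV f" using assms by (rule test_fun_continuous)
  have "integrable lborel (\<lambda>x. (cmod (f x))\<^sup>2)"
    using K c by (intro integrable_lborel_compact_support[of _ K] continuous_intros) auto
  moreover have "f \<in> borel_measurable borel"
    using c by (rule borel_measurable_continuous_onI)
  ultimately show ?thesis
    by (auto simp: square_integrable_def integrable_completion intro!: measurable_completion)
qed

lemma abs_L2_test_fun_in_L2_on:
  assumes "f \<in> test_fun \<Omega>"
  shows "abs_L2 f \<in> L2_on \<Omega>"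
proof -
  obtain K where "K \<subseteq> \<Omega>" "\<And>x. x \<notin> K \<Longrightarrow> f x = 0" using assms by (rule test_funE) blast
  then show ?thesis
    using square_integrable_test_fun[OF assms] by (auto simp: abs_L2_in_L2_on)
qed

section \<open>Integration by parts\<close>

lemma lborel_integral_translate:
  fixes f :: "'a::euclidean_space \<Rightarrow> complex"
  assumes "f \<in> borel_measurable borel"
  shows "(LINT x|lborel. f (x + c)) = (LINT x|lborel. f x)"
proof -
  have "(LINT x|lborel. f x) = (LINT x|distr lborel borel ((+) c). f x)"
    by (simp add: lborel_distr_plus)
  also have "\<dots> = (LINT x|lborel. f (c + x))"
    using assms by (intro integral_distr) auto
  finally show ?thesis by (simp add: add.commute)
qed

text \<open>
  The difference quotients of \<open>h\<close> in the direction of an axis have integral zero by translation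
  invariance. They are bounded by the maximum of the partial derivative and supported in a common
  compact set, so dominated convergence applies.
\<close>

lemma integral_partial_deriv_eq_zero:
  fixes h :: "real^'n \<Rightarrow> complex"
  assumes diff: "\<And>x. h differentiable (at x)" and cont: "continuous_on UNIV (partial_deriv k h)"
    and K: "compact K" "\<And>x. x \<notin> K \<Longrightarrow> h x = 0" "\<And>x. x \<notin> K \<Longrightarrow> partial_deriv k h x = 0"
  shows "(LINT x|lborel. partial_deriv k h x) = 0"
proof -
  let ?e = "axis k 1 :: real^'n"
  define s where "s n = inverse (real (Suc n))" for n
  have s: "0 < s n" "s n \<le> 1" for n by (auto simp: s_def field_simps)
  define F where "F n x = (h (x + s n *\<^sub>R ?e) - h x) /\<^sub>R s n" for n x
  have hc: "continuous_on UNIV h"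
    using diff by (auto simp: continuous_on_eq_continuous_at intro: differentiable_imp_continuous_within)
  then have hb [measurable]: "h \<in> borel_measurable borel" by (rule borel_measurable_continuous_onI)
  obtain B where B: "\<And>x. cmod (partial_deriv k h x) \<le> B"
  proof -
    have "bounded (partial_deriv k h ` K)"
      using K(1) cont by (intro compact_imp_bounded compact_continuous_image) (auto intro: continuous_on_subset)
    then obtain B where B: "\<And>x. x \<in> K \<Longrightarrow> cmod (partial_deriv k h x) \<le> B"
      by (auto simp: bounded_iff)
    have "cmod (partial_deriv k h x) \<le> max B 0" for x
      using B[of x] K(3)[of x] by (cases "x \<in> K") auto
    then show thesis using that by blast
  qed
  let ?L = "(\<lambda>(x, t). x - t *\<^sub>R ?e) ` (K \<times> {0..1})"
  have L: "compact ?L"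
    using K(1) by (intro compact_continuous_image compact_Times) (auto simp: case_prod_beta intro!: continuous_intros)
  have F_lim: "(\<lambda>n. F n x) \<longlonglongrightarrow> partial_deriv k h x" for x
  proof -
    let ?D = "partial_deriv k h x"
    have "((\<lambda>t. (h (x + t *\<^sub>R ?e) - h x - t *\<^sub>R ?D) /\<^sub>R \<bar>t\<bar>) \<longlongrightarrow> 0) (at 0)"
      using has_vector_derivative_partial_deriv_0[OF diff, of x k]
      by (simp add: has_vector_derivative_def has_derivative_at_within)
    then have lim: "((\<lambda>t. norm ((h (x + t *\<^sub>R ?e) - h x - t *\<^sub>R ?D) /\<^sub>R \<bar>t\<bar>)) \<longlongrightarrow> 0) (at 0)"
      by (rule tendsto_norm_zero)
    have "norm ((h (x + t *\<^sub>R ?e) - h x - t *\<^sub>R ?D) /\<^sub>R \<bar>t\<bar>)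
        = norm ((h (x + t *\<^sub>R ?e) - h x) /\<^sub>R t - ?D)" if "t \<noteq> 0" for t
    proof -
      have "(h (x + t *\<^sub>R ?e) - h x) /\<^sub>R t - ?D = (h (x + t *\<^sub>R ?e) - h x - t *\<^sub>R ?D) /\<^sub>R t"
        using that by (simp add: scaleR_diff_right)
      then show ?thesis by simp
    qed
    then have "((\<lambda>t. norm ((h (x + t *\<^sub>R ?e) - h x) /\<^sub>R t - ?D)) \<longlongrightarrow> 0) (at 0)"
      by (intro Lim_transform_eventually[OF lim]) (auto simp: eventually_at_filter)
    then have "((\<lambda>t. (h (x + t *\<^sub>R ?e) - h x) /\<^sub>R t) \<longlongrightarrow> ?D) (at 0)"
      by (rule tendsto_norm_zero_cancel[THEN LIM_zero_cancel])
    moreover have "filterlim s (at 0) sequentially"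
      unfolding filterlim_at using LIMSEQ_inverse_real_of_nat s by (auto simp: s_def[abs_def])
    ultimately show ?thesis unfolding F_def by (rule filterlim_compose)
  qed
  have F_bound: "norm (F n x) \<le> B * indicator ?L x" for n x
  proof (cases "x \<in> ?L")
    case True
    have "norm (h (x + s n *\<^sub>R ?e) - h (x + 0 *\<^sub>R ?e)) \<le> B * norm (s n - 0)"
    proof (rule differentiable_bound)
      show "((\<lambda>t. h (x + t *\<^sub>R ?e)) has_derivative (\<lambda>r. r *\<^sub>R partial_deriv k h (x + t *\<^sub>R ?e)))
          (at t within {0..s n})" for t
        using has_vector_derivative_partial_deriv[OF diff, where x = x and s = t and k = k]
        by (auto simp: has_vector_derivative_def intro: has_derivative_at_withinI)
      show "onorm (\<lambda>r. r *\<^sub>R partial_deriv k h (x + t *\<^sub>R ?e)) \<le> B" for t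
        using B by (intro onorm_le) (simp add: mult.commute[of B] mult_left_mono)
    qed (use s[of n] in auto)
    then show ?thesis
      using True s[of n] by (simp add: F_def divide_inverse_commute[symmetric] pos_divide_le_eq)
  next
    case False
    have "x + s n *\<^sub>R ?e \<notin> K"
    proof
      assume "x + s n *\<^sub>R ?e \<in> K"
      then have "x \<in> ?L" using s[of n] by (intro image_eqI[of _ _ "(x + s n *\<^sub>R ?e, s n)"]) auto
      then show False using False by simp
    qed
    moreover have "x \<notin> K"
    proof
      assume "x \<in> K"
      then have "x \<in> ?L" by (intro image_eqI[of _ _ "(x, 0)"]) auto
      then show False using False by simp
    qed
    ultimately show ?thesis using False K(2) by (simp add: F_def)
  qed
  have "integrable lborel h"
    using hc K by (intro integrable_lborel_compact_support[of h K]) auto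
  moreover have "integrable lborel (\<lambda>x. h (x + c))" for c
  proof (rule integrable_lborel_compact_support[of _ "(\<lambda>x. x - c) ` K"])
    show "compact ((\<lambda>x. x - c) ` K)" using K(1) by (intro compact_continuous_image continuous_intros)
    show "continuous_on UNIV (\<lambda>x. h (x + c))"
      by (rule continuous_on_compose2[OF hc]) (auto intro!: continuous_intros)
    show "h (x + c) = 0" if "x \<notin> (\<lambda>x. x - c) ` K" for x
      using that by (intro K(2)) (auto simp: image_iff algebra_simps)
  qed
  ultimately have F_int: "(LINT x|lborel. F n x) = 0" for n
    using lborel_integral_translate[OF hb, of "s n *\<^sub>R ?e"] by (simp add: F_def)
  have "(\<lambda>n. LINT x|lborel. F n x) \<longlonglongrightarrow> (LINT x|lborel. partial_deriv k h x)"
  proof (rule integral_dominated_convergence[where w = "\<lambda>x. B * indicator ?L x"])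
    show "partial_deriv k h \<in> borel_measurable lborel"
      using borel_measurable_continuous_onI[OF cont] by simp
    show "F n \<in> borel_measurable lborel" for n unfolding F_def by measurable
    show "integrable lborel (\<lambda>x. B * indicator ?L x)"
      using L emeasure_bounded_finite[OF compact_imp_bounded[OF L]]
      by (intro integrable_mult_right integrable_real_indicator) (auto intro: borel_compact)
  qed (use F_lim F_bound in auto)
  then show ?thesis using LIMSEQ_unique[OF _ tendsto_const] by (simp add: F_int)
qed

lemma integration_by_parts_test_fun:
  assumes "f \<in> test_fun \<Omega>" "g \<in> test_fun \<Omega>"
  shows "cinner (abs_L2 f) (abs_L2 (partial_deriv k g)) = - cinner (abs_L2 (partial_deriv k f)) (abs_L2 g)"
proof -
  note si = square_integrable_test_fun[OF assms(1)] square_integrable_test_fun[OF assms(2)]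
    square_integrable_test_fun[OF test_fun_partial_deriv[OF assms(1)], of k]
    square_integrable_test_fun[OF test_fun_partial_deriv[OF assms(2)], of k]
  let ?h = "\<lambda>x. cnj (f x) * g x"
  let ?h' = "\<lambda>x. cnj (f x) * partial_deriv k g x + cnj (partial_deriv k f x) * g x"
  have d: "(\<lambda>x. cnj (f x)) differentiable (at x)" for x
    using has_derivative_cnj[of f _ "at x"] test_fun_differentiable[OF assms(1), of x]
    unfolding differentiable_def by blast
  note diff = d test_fun_differentiable[OF assms(2)]
  have pd: "partial_deriv k ?h = ?h'"
    by (intro ext) (simp add: partial_deriv_mult diff partial_deriv_cnj test_fun_differentiable[OF assms(1)])
  have c: "continuous_on UNIV ?h'"
    using assms by (intro continuous_intros test_fun_continuous test_fun_continuous_partial_deriv)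
  obtain K where K: "compact K" "\<And>x. x \<notin> K \<Longrightarrow> f x = 0" "\<And>x. x \<notin> K \<Longrightarrow> partial_deriv k f x = 0"
    using assms(1) by (rule test_funE) blast
  have "(LINT x|lborel. ?h' x) = 0"
    using integral_partial_deriv_eq_zero[of ?h k K] K c
    by (simp add: pd differentiable_mult diff)
  then have "(LINT x|lebesgue. ?h' x) = 0"
    using borel_measurable_continuous_onI[OF c] by (subst integral_completion) simp_all
  then show ?thesis
    using si by (simp add: cinner_abs_L2 square_integrable_product eq_neg_iff_add_eq_0)
qed

section \<open>Smooth functions positive exactly on a box\<close>

text \<open>
  The factor \<open>exp (- c / t)\<close> makes the function and all its derivatives vanish at \<open>0\<close>. The polynomial in
  \<open>1 / t\<close> serves to have a class that is closed under differentiation, and the parameter \<open>c\<close> to let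
  \<open>flat c 1\<close> increase to the indicator function of the positive reals as \<open>c\<close> tends to \<open>0\<close>.
\<close>

definition flat :: "real \<Rightarrow> real poly \<Rightarrow> real \<Rightarrow> real" where
  "flat c P t = (if 0 < t then poly P (1 / t) * exp (- c / t) else 0)"

lemma poly_times_exp_tendsto_0:
  assumes "0 < (c :: real)"
  shows "((\<lambda>y. y ^ k * poly P y * exp (- (c * y))) \<longlongrightarrow> 0) at_top"
proof (induction P arbitrary: k)
  case (pCons a P)
  have pow: "((\<lambda>y. y ^ k * exp (- (c * y))) \<longlongrightarrow> 0) at_top"
  proof -
    have "((\<lambda>y. (c * y) ^ k / exp (c * y)) \<longlongrightarrow> 0) at_top"
      by (rule filterlim_compose[OF tendsto_power_div_exp_0])
        (use assms in \<open>intro filterlim_tendsto_pos_mult_at_top[OF tendsto_const] filterlim_ident\<close>)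
    then have "((\<lambda>y. (1 / c ^ k) * ((c * y) ^ k / exp (c * y))) \<longlongrightarrow> (1 / c ^ k) * 0) at_top"
      by (intro tendsto_intros)
    then show ?thesis
      using assms by (simp add: power_mult_distrib exp_minus field_simps)
  qed
  have "((\<lambda>y. a * (y ^ k * exp (- (c * y))) + y ^ Suc k * poly P y * exp (- (c * y))) \<longlongrightarrow> a * 0 + 0) at_top"
    by (intro tendsto_intros pow pCons.IH)
  then show ?case by (simp add: algebra_simps)
qed simp

text \<open>
  The polynomial of the derivative comes from the product rule and \<open>d/dt (1 / t) = - (1 / t)\<^sup>2\<close>. At \<open>0\<close>
  the difference quotient tends to zero by the preceding limit, taken at \<open>y = 1 / t\<close>.
\<close>

lemma flat_has_real_derivative:
  assumes c: "0 < c"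
  shows "(flat c P has_real_derivative flat c ([:0, 0, 1:] * (smult c P - pderiv P)) t) (at t)"
proof -
  let ?Q = "[:0, 0, 1:] * (smult c P - pderiv P)"
  consider "0 < t" | "t < 0" | "t = 0" by linarith
  then show ?thesis
  proof cases
    case 1
    have "((\<lambda>t. poly P (1 / t) * exp (- c / t)) has_real_derivative
        poly ?Q (1 / t) * exp (- c / t)) (at t)"
      using 1 by (auto intro!: derivative_eq_intros DERIV_chain2[OF poly_DERIV]
          simp: field_simps power2_eq_square)
    then have "((\<lambda>t. poly P (1 / t) * exp (- c / t)) has_real_derivative flat c ?Q t) (at t)"
      using 1 by (simp add: flat_def)
    then show ?thesis
      by (rule has_field_derivative_transform_within_open[of _ _ _ "{0<..}"])
        (use 1 in \<open>auto simp: flat_def\<close>)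
  next
    case 2
    have "((\<lambda>t. 0) has_real_derivative flat c ?Q t) (at t)"
      using 2 by (simp add: flat_def)
    then show ?thesis
      by (rule has_field_derivative_transform_within_open[of _ _ _ "{..<0}"])
        (use 2 in \<open>auto simp: flat_def\<close>)
  next
    case 3
    have "((\<lambda>s. flat c P s / s) \<longlongrightarrow> 0) (at_right 0)"
    proof -
      have "((\<lambda>s. (inverse s) ^ 1 * poly P (inverse s) * exp (- (c * inverse s))) \<longlongrightarrow> 0) (at_right 0)"
        by (rule filterlim_compose[OF poly_times_exp_tendsto_0[OF c] filterlim_inverse_at_top_right])
      then show ?thesis
        by (rule Lim_transform_eventually)
          (auto simp: flat_def eventually_at_filter divide_inverse)
    qed
    moreover have "((\<lambda>s. flat c P s / s) \<longlongrightarrow> 0) (at_left 0)"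
      by (rule Lim_transform_eventually[OF tendsto_const])
        (auto simp: flat_def eventually_at_filter)
    ultimately have "((\<lambda>s. flat c P s / s) \<longlongrightarrow> 0) (at 0)"
      by (simp add: filterlim_at_split)
    then show ?thesis using 3 unfolding has_field_derivative_iff by (simp add: flat_def)
  qed
qed

text \<open>
  The induction has to run over all polynomials, as a partial derivative is again a function of this
  form, with another polynomial and up to a constant factor.
\<close>

lemma C_diff_flat:
  fixes i :: "'n::finite"
  assumes c: "0 < c"
  shows "C_diff m (\<lambda>x :: real^'n. complex_of_real (flat c P (r * x $ i + d)))"
proof (induction m arbitrary: P)
  case 0
  have "continuous_on UNIV (flat c P)"
    using DERIV_isCont[OF flat_has_real_derivative[OF c]] by (simp add: continuous_on_eq_continuous_at)
  then have "continuous_on UNIV (\<lambda>x :: real^'n. flat c P (r * x $ i + d))"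
    by (rule continuous_on_compose2) (auto intro!: continuous_intros)
  then show ?case by (auto intro: continuous_on_of_real)
next
  case (Suc m)
  let ?Q = "[:0, 0, 1:] * (smult c P - pderiv P)"
  have "(\<lambda>x :: real^'n. complex_of_real (flat c P (r * x $ i + d))) differentiable (at x)" for x
  proof -
    have "(flat c P has_derivative (\<lambda>h. h * flat c ?Q (r * x $ i + d))) (at (r * x $ i + d))"
      using flat_has_real_derivative[OF c, of P "r * x $ i + d"]
      by (simp add: has_field_derivative_def mult_commute_abs)
    moreover have "((\<lambda>x :: real^'n. r * x $ i + d) has_derivative (\<lambda>h. r * h $ i)) (at x)"
      by (auto intro!: derivative_eq_intros bounded_linear.has_derivative[OF bounded_linear_vec_nth])
    ultimately have "((\<lambda>x. flat c P (r * x $ i + d)) has_derivative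
        (\<lambda>h. (r * h $ i) * flat c ?Q (r * x $ i + d))) (at x)"
      using has_derivative_compose by fastforce
    then show ?thesis
      using bounded_linear.has_derivative[OF bounded_linear_of_real] unfolding differentiable_def by blast
  qed
  moreover have "C_diff m (partial_deriv k (\<lambda>x :: real^'n. complex_of_real (flat c P (r * x $ i + d))))" for k
  proof -
    have "partial_deriv k (\<lambda>x :: real^'n. complex_of_real (flat c P (r * x $ i + d)))
        = (\<lambda>x. complex_of_real (if k = i then r else 0) * complex_of_real (flat c ?Q (r * x $ i + d)))"
    proof (intro ext partial_deriv_eqI)
      fix x :: "real^'n"
      let ?b = "if k = i then r else 0"
      have "((\<lambda>t. flat c P (r * (x + t *\<^sub>R axis k 1) $ i + d)) has_real_derivative
          flat c ?Q (r * (x + 0 *\<^sub>R axis k 1) $ i + d) * ?b) (at 0)"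
        by (rule DERIV_chain2[OF flat_has_real_derivative[OF c]])
          (auto intro!: derivative_eq_intros simp: axis_def)
      from has_vector_derivative_of_real[OF this]
      show "((\<lambda>t. complex_of_real (flat c P (r * (x + t *\<^sub>R axis k 1) $ i + d)))
          has_vector_derivative complex_of_real ?b * complex_of_real (flat c ?Q (r * x $ i + d))) (at 0)"
        by (simp add: mult.commute)
    qed
    then show ?thesis by (simp only:) (intro C_diff_mult C_diff_const Suc.IH)
  qed
  ultimately show ?case by simp
qed

definition box_bump :: "real \<Rightarrow> real^'n \<Rightarrow> real^'n \<Rightarrow> real^'n \<Rightarrow> real" where
  "box_bump c a b x = (\<Prod>i\<in>UNIV. flat c 1 (x $ i - a $ i) * flat c 1 (b $ i - x $ i))"

lemma flat_one: "flat c 1 t = (if 0 < t then exp (- c / t) else 0)"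
  by (simp add: flat_def)

lemma box_bump_outside:
  assumes "x \<notin> box a b"
  shows "box_bump c a b x = 0"
proof -
  obtain i where "x $ i \<le> a $ i \<or> b $ i \<le> x $ i"
    using assms by (auto simp: mem_box_cart not_less)
  then show ?thesis
    unfolding box_bump_def by (intro prod_zero bexI[of _ i]) (auto simp: flat_one)
qed

lemma box_bump_bounds:
  assumes "0 < c"
  shows "0 \<le> box_bump c a b x" "box_bump c a b x \<le> 1"
proof -
  have "0 \<le> flat c 1 t" "flat c 1 t \<le> 1" for t using assms by (auto simp: flat_one)
  then show "0 \<le> box_bump c a b x" "box_bump c a b x \<le> 1"
    unfolding box_bump_def by (auto intro!: prod_nonneg prod_le_1 mult_le_one mult_nonneg_nonneg)
qed

lemma box_bump_test_fun:
  assumes "0 < c" "cbox a b \<subseteq> \<Omega>"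
  shows "(\<lambda>x. complex_of_real (box_bump c a b x)) \<in> test_fun \<Omega>"
proof (rule test_funI[of _ "cbox a b"])
  have "C_diff m (\<lambda>x. \<Prod>i\<in>UNIV. complex_of_real (flat c 1 (1 * x $ i + (- a $ i)))
      * complex_of_real (flat c 1 ((- 1) * x $ i + b $ i)))" for m
    by (intro C_diff_prod C_diff_mult C_diff_flat assms)
  then show "C_diff m (\<lambda>x. complex_of_real (box_bump c a b x))" for m
    by (simp add: box_bump_def)
  show "complex_of_real (box_bump c a b x) = 0" if "x \<notin> cbox a b" for x
    using that box_subset_cbox[of a b] by (subst box_bump_outside) auto
qed (use assms in auto)

text \<open>
  The limit is the indicator function of the open box: the bump vanishes outside it for every \<open>c\<close>, and
  inside it each of the finitely many factors tends to \<open>1\<close>.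
\<close>

lemma box_bump_tendsto: "(\<lambda>n. box_bump (inverse (real (Suc n))) a b x) \<longlonglongrightarrow> indicator (box a b) x"
proof (cases "x \<in> box a b")
  case True
  then have pos: "0 < x $ i - a $ i" "0 < b $ i - x $ i" for i by (auto simp: mem_box_cart)
  have one: "(\<lambda>n. flat (inverse (real (Suc n))) 1 t) \<longlonglongrightarrow> 1" if "0 < t" for t
  proof -
    have "(\<lambda>n. exp (- inverse (real (Suc n)) / t)) \<longlonglongrightarrow> exp (- 0 / t)"
      using that by (intro tendsto_intros LIMSEQ_inverse_real_of_nat) auto
    then show ?thesis using that by (simp add: flat_one)
  qed
  have "(\<lambda>n. box_bump (inverse (real (Suc n))) a b x) \<longlonglongrightarrow> (\<Prod>i\<in>(UNIV :: 'a set). 1 * 1)"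
    unfolding box_bump_def by (intro tendsto_prod tendsto_mult one pos)
  then show ?thesis using True by simp
qed (simp add: box_bump_outside)

section \<open>Density of the test functions\<close>

lemma enn2real_cancel: "a \<noteq> \<infinity> \<Longrightarrow> b \<noteq> \<infinity> \<Longrightarrow> enn2real a = enn2real b \<Longrightarrow> a = b"
  by (cases a; cases b; simp)

text \<open>
  The positive and the negative part of \<open>g\<close> are the densities of two finite measures. These agree on
  the boxes, which generate the Borel sets and are stable under intersection, hence they are equal.
\<close>

lemma AE_zero_if_box_integrals_zero_real:
  fixes g :: "'a::euclidean_space \<Rightarrow> real"
  assumes g: "integrable lborel g" and zero: "\<And>a b. (LINT x|lborel. indicator (box a b) x * g x) = 0"
  shows "AE x in lborel. g x = 0"
proof -
  let ?p = "\<lambda>x. ennreal (g x)" and ?m = "\<lambda>x. ennreal (- g x)"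
  have [measurable]: "g \<in> borel_measurable borel"
    using borel_measurable_integrable[OF g] by simp
  have fin: "(\<integral>\<^sup>+x. ?p x \<partial>lborel) \<noteq> \<infinity>" "(\<integral>\<^sup>+x. ?m x \<partial>lborel) \<noteq> \<infinity>"
    using g unfolding real_integrable_def by - (elim conjE, assumption)+
  have box_eq: "emeasure (density lborel ?p) (box a b) = emeasure (density lborel ?m) (box a b)" for a b
  proof -
    let ?f = "\<lambda>x. indicator (box a b) x * g x"
    have int: "integrable lborel ?f"
      using integrable_mult_indicator[OF _ g, of "box a b"] by simp
    have p: "(\<integral>\<^sup>+x. ?p x * indicator (box a b) x \<partial>lborel) = (\<integral>\<^sup>+x. ennreal (?f x) \<partial>lborel)"
      and m: "(\<integral>\<^sup>+x. ?m x * indicator (box a b) x \<partial>lborel) = (\<integral>\<^sup>+x. ennreal (- ?f x) \<partial>lborel)"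
      by (auto intro!: nn_integral_cong split: split_indicator)
    have "(\<integral>\<^sup>+x. ennreal (?f x) \<partial>lborel) \<noteq> \<infinity>" "(\<integral>\<^sup>+x. ennreal (- ?f x) \<partial>lborel) \<noteq> \<infinity>"
      using int unfolding real_integrable_def by - (elim conjE, assumption)+
    moreover have "enn2real (\<integral>\<^sup>+x. ennreal (?f x) \<partial>lborel) = enn2real (\<integral>\<^sup>+x. ennreal (- ?f x) \<partial>lborel)"
      using zero[of a b] real_lebesgue_integral_def[OF int] by simp
    ultimately have "(\<integral>\<^sup>+x. ennreal (?f x) \<partial>lborel) = (\<integral>\<^sup>+x. ennreal (- ?f x) \<partial>lborel)"
      by (rule enn2real_cancel)
    then show ?thesis by (simp add: emeasure_density p m)
  qed
  have "density lborel ?p = density lborel ?m"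
  proof (rule measure_eqI_generator_eq)
    let ?E = "range (\<lambda>(a, b). box a b :: 'a set)"
    show "Int_stable ?E" by (auto simp: Int_stable_def box_Int_box)
    show "?E \<subseteq> Pow UNIV" by simp
    show "sets (density lborel ?p) = sigma_sets UNIV ?E" "sets (density lborel ?m) = sigma_sets UNIV ?E"
      by (simp_all add: borel_eq_box)
    let ?A = "\<lambda>n::nat. box (- (real n *\<^sub>R One)) (real n *\<^sub>R One) :: 'a set"
    show "range ?A \<subseteq> ?E" "(\<Union>i. ?A i) = UNIV" unfolding UN_box_eq_UNIV by auto
    show "emeasure (density lborel ?p) (?A i) \<noteq> \<infinity>" for i
    proof -
      have "(\<integral>\<^sup>+x. ?p x * indicator (?A i) x \<partial>lborel) \<le> (\<integral>\<^sup>+x. ?p x \<partial>lborel)"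
        by (intro nn_integral_mono) (auto split: split_indicator)
      then show ?thesis using fin(1) by (auto simp: emeasure_density top_unique)
    qed
    show "emeasure (density lborel ?p) X = emeasure (density lborel ?m) X" if "X \<in> ?E" for X
      using that box_eq by auto
  qed
  then have "AE x in lborel. ?p x = ?m x"
    using fin by (subst (asm) finite_density_unique) auto
  then show ?thesis
  proof eventually_elim
    fix x assume "?p x = ?m x"
    then show "g x = 0"
      by (cases "0 \<le> g x") (auto simp: ennreal_neg dest: sym)
  qed
qed

text \<open>
  The passage from Lebesgue to Borel measurable functions goes through a Borel function that agrees
  almost everywhere.
\<close>

lemma AE_zero_if_box_integrals_zero:
  fixes v :: "'a::euclidean_space \<Rightarrow> complex"
  assumes v: "integrable lebesgue v" and zero: "\<And>a b. (LINT x|lebesgue. indicator (box a b) x *\<^sub>R v x) = 0"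
  shows "AE x in lebesgue. v x = 0"
proof -
  have real: "AE x in lebesgue. g x = 0"
    if g: "integrable lebesgue g" and zero: "\<And>a b. (LINT x|lebesgue. indicator (box a b) x * g x) = 0"
    for g :: "'a \<Rightarrow> real"
  proof -
    obtain g' where [measurable]: "g' \<in> borel_measurable lborel" and eq: "AE x in lborel. g x = g' x"
      using completion_ex_borel_measurable_real[OF borel_measurable_integrable[OF g]] by blast
    have meas: "g \<in> borel_measurable lebesgue" "g' \<in> borel_measurable lebesgue"
      using g by (auto intro: measurable_completion)
    have ae: "AE x in lebesgue. g x = g' x" using eq by (rule AE_completion)
    have "integrable lebesgue g'"
      using integrable_cong_AE[OF meas ae] g by simp
    then have "integrable lborel g'" by (simp add: integrable_completion)
    moreover have "(LINT x|lborel. indicator (box a b) x * g' x) = 0" for a b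
    proof -
      have "(LINT x|lborel. indicator (box a b) x * g' x) = (LINT x|lebesgue. indicator (box a b) x * g' x)"
        by (rule integral_completion[symmetric]) measurable
      also have "\<dots> = (LINT x|lebesgue. indicator (box a b) x * g x)"
      proof (rule integral_cong_AE)
        show "AE x in lebesgue. indicator (box a b) x * g' x = indicator (box a b) x * g x"
          using ae by eventually_elim simp
      qed (use meas in \<open>auto intro!: borel_measurable_times borel_measurable_indicator\<close>)
      finally show ?thesis using zero by simp
    qed
    ultimately have "AE x in lborel. g' x = 0" by (rule AE_zero_if_box_integrals_zero_real)
    then have "AE x in lebesgue. g' x = 0" by (rule AE_completion)
    with ae show ?thesis by eventually_elim simp
  qed
  have int: "integrable lebesgue (\<lambda>x. indicator (box a b) x *\<^sub>R v x)" for a b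
    using v by (intro integrable_mult_indicator) auto
  have "(LINT x|lebesgue. indicator (box a b) x * Re (v x)) = 0"
    "(LINT x|lebesgue. indicator (box a b) x * Im (v x)) = 0" for a b
    using integral_Re[OF int[of a b]] integral_Im[OF int[of a b]] zero[of a b] by simp_all
  then have "AE x in lebesgue. Re (v x) = 0" "AE x in lebesgue. Im (v x) = 0"
    using v by (intro real; simp)+
  then show ?thesis by eventually_elim (simp add: complex_eq_iff)
qed

lemma integrable_box_times_square_integrable:
  assumes "square_integrable u"
  shows "integrable lebesgue (\<lambda>x. indicator (box a b) x *\<^sub>R u x)"
proof -
  have "square_integrable (\<lambda>x. complex_of_real (indicator (box a b) x))"
  proof -
    have "integrable lebesgue (\<lambda>x. indicator (box a b) x :: real)"
      by (intro integrable_real_indicator) (use emeasure_bounded_finite[OF bounded_box, of a b] in auto)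
    moreover have "(\<lambda>x. (cmod (complex_of_real (indicator (box a b) x)))\<^sup>2) = (\<lambda>x. indicator (box a b) x)"
      by (auto simp: indicator_def)
    ultimately show ?thesis by (auto simp: square_integrable_def)
  qed
  from square_integrable_product[OF this assms] show ?thesis by (simp add: scaleR_conv_of_real)
qed

text \<open>
  Dominated convergence along the bumps shows that the integral over every box whose closure lies
  in \<open>\<Omega>\<close> vanishes; so the function vanishes almost everywhere on each such box. Countably many of the
  closed boxes cover \<open>\<Omega>\<close>.
\<close>

lemma orthogonal_to_test_fun_eq_zero:
  fixes f :: "(real^'n) L2"
  assumes \<Omega>: "open \<Omega>" and f: "f \<in> L2_on \<Omega>"
    and orth: "\<And>\<phi>. \<phi> \<in> test_fun \<Omega> \<Longrightarrow> cinner f (abs_L2 \<phi>) = 0"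
  shows "f = 0"
proof -
  obtain u where u: "square_integrable u" "f = abs_L2 u" by (rule L2_cases)
  then have [measurable]: "u \<in> borel_measurable lebesgue" by (simp add: square_integrable_def)
  have box: "(LINT x|lebesgue. indicator (box a b) x *\<^sub>R u x) = 0" if ab: "cbox a b \<subseteq> \<Omega>" for a b
  proof -
    define c where "c n = inverse (real (Suc n))" for n
    have c: "0 < c n" for n by (simp add: c_def)
    let ?b = "\<lambda>n x. box_bump (c n) a b x"
    have test: "(\<lambda>x. complex_of_real (?b n x)) \<in> test_fun \<Omega>" for n
      using ab c by (intro box_bump_test_fun)
    then have bu: "square_integrable (\<lambda>x. complex_of_real (?b n x))" for n
      by (rule square_integrable_test_fun)
    have "(LINT x|lebesgue. ?b n x *\<^sub>R u x) = 0" for n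
      using orth[OF test, of n] cinner_commute[of "abs_L2 (\<lambda>x. complex_of_real (?b n x))" f]
      by (simp add: u cinner_abs_L2[OF bu u(1)] scaleR_conv_of_real)
    moreover have "(\<lambda>n. LINT x|lebesgue. ?b n x *\<^sub>R u x)
        \<longlonglongrightarrow> (LINT x|lebesgue. indicator (box a b) x *\<^sub>R u x)"
    proof (rule integral_dominated_convergence[where w = "\<lambda>x. norm (indicator (box a b) x *\<^sub>R u x)"])
      show "(\<lambda>x. indicator (box a b) x *\<^sub>R u x) \<in> borel_measurable lebesgue"
        using integrable_box_times_square_integrable[OF u(1)] by (rule borel_measurable_integrable)
      show "(\<lambda>x. ?b n x *\<^sub>R u x) \<in> borel_measurable lebesgue" for n
        using square_integrable_product[OF bu u(1), of n]
        by (simp add: borel_measurable_integrable scaleR_conv_of_real)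
      show "integrable lebesgue (\<lambda>x. norm (indicator (box a b) x *\<^sub>R u x))"
        using integrable_box_times_square_integrable[OF u(1)] by (rule integrable_norm)
      show "AE x in lebesgue. (\<lambda>n. ?b n x *\<^sub>R u x) \<longlonglongrightarrow> indicator (box a b) x *\<^sub>R u x"
        unfolding c_def by (intro AE_I2 tendsto_scaleR box_bump_tendsto tendsto_const)
      show "AE x in lebesgue. norm (?b n x *\<^sub>R u x) \<le> norm (indicator (box a b) x *\<^sub>R u x)" for n
      proof (intro AE_I2)
        fix x
        have "\<bar>?b n x\<bar> \<le> indicator (box a b) x"
          using box_bump_bounds[OF c, of n a b x]
          by (cases "x \<in> box a b") (auto simp: box_bump_outside)
        then show "norm (?b n x *\<^sub>R u x) \<le> norm (indicator (box a b) x *\<^sub>R u x)"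
          by (simp add: mult_right_mono)
      qed
    qed
    ultimately show ?thesis using LIMSEQ_unique[OF _ tendsto_const] by force
  qed
  have ae_box: "AE x in lebesgue. x \<in> cbox a b \<longrightarrow> u x = 0" if ab: "cbox a b \<subseteq> \<Omega>" for a b
  proof -
    have "AE x in lebesgue. indicator (box a b) x *\<^sub>R u x = 0"
    proof (rule AE_zero_if_box_integrals_zero)
      show "integrable lebesgue (\<lambda>x. indicator (box a b) x *\<^sub>R u x)"
        by (rule integrable_box_times_square_integrable[OF u(1)])
      fix a' b'
      obtain a'' b'' where Int: "box a' b' \<inter> box a b = box a'' b''" by (rule that[OF box_Int_box])
      have "(LINT x|lebesgue. indicator (box a'' b'') x *\<^sub>R u x) = 0"
      proof (cases "box a'' b'' = {}")
        case False
        then have "cbox a'' b'' = closure (box a'' b'')" by (simp add: closure_box)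
        also have "\<dots> \<subseteq> closure (box a b)" by (intro closure_mono) (use Int in blast)
        also have "\<dots> \<subseteq> cbox a b" by (intro closure_minimal box_subset_cbox closed_cbox)
        finally have "cbox a'' b'' \<subseteq> \<Omega>" using ab by blast
        then show ?thesis by (rule box)
      qed simp
      then show "(LINT x|lebesgue. indicator (box a' b') x *\<^sub>R indicator (box a b) x *\<^sub>R u x) = 0"
        by (simp add: Int[symmetric] indicator_inter_arith)
    qed
    moreover have "AE x in lebesgue. x \<notin> cbox a b - box a b"
      using negligible_frontier_interval[of a b] by (intro AE_not_in) (simp add: negligible_iff_null_sets)
    ultimately show ?thesis by eventually_elim (auto simp: indicator_def)
  qed
  obtain D where D: "countable D" "D \<subseteq> Pow \<Omega>" "\<And>X. X \<in> D \<Longrightarrow> \<exists>a b. X = cbox a b" "\<Union>D = \<Omega>"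
    using open_countable_Union_open_cbox[OF \<Omega>] by metis
  have "AE x in lebesgue. \<forall>X\<in>D. x \<in> X \<longrightarrow> u x = 0"
    using D(2,3) ae_box by (subst AE_ball_countable[OF D(1)]) blast
  moreover have "AE x in lebesgue. x \<notin> \<Omega> \<longrightarrow> u x = 0"
    using f u by (simp add: abs_L2_in_L2_on)
  ultimately have "AE x in lebesgue. u x = 0"
    by eventually_elim (use D(4) in blast)
  then show ?thesis
    using u by (simp add: zero_abs_L2 abs_L2_eq_iff square_integrable_zero)
qed

lemma csubspace_test_fun: "csubspace (abs_L2 ` test_fun \<Omega>)"
  unfolding csubspace_def
proof (intro conjI ballI allI)
  show "0 \<in> abs_L2 ` test_fun \<Omega>" using test_fun_zero by (auto simp: zero_abs_L2)
  fix f g assume "f \<in> abs_L2 ` test_fun \<Omega>" "g \<in> abs_L2 ` test_fun \<Omega>"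
  then show "f + g \<in> abs_L2 ` test_fun \<Omega>"
    by (auto simp: add_abs_L2 square_integrable_test_fun intro!: imageI test_fun_add)
  show "a *\<^sub>C f \<in> abs_L2 ` test_fun \<Omega>" for a
    using \<open>f \<in> _\<close> by (auto simp: scaleC_abs_L2 square_integrable_test_fun intro!: imageI test_fun_scale)
qed

lemma test_fun_dense:
  assumes "open (\<Omega> :: (real^'n) set)"
  shows "L2_on \<Omega> \<subseteq> closure (abs_L2 ` test_fun \<Omega>)"
proof
  fix f assume f: "f \<in> L2_on \<Omega>"
  show "f \<in> closure (abs_L2 ` test_fun \<Omega>)"
  proof (rule in_closure_if_orthogonal_to_complement[OF csubspace_L2_on _ csubspace_test_fun _ f])
    show "closed (L2_on \<Omega>)" using assms by (intro closed_L2_on) auto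
    show "abs_L2 ` test_fun \<Omega> \<subseteq> L2_on \<Omega>" by (auto intro: abs_L2_test_fun_in_L2_on)
    show "cinner z f = 0" if "z \<in> L2_on \<Omega>" "\<And>y. y \<in> abs_L2 ` test_fun \<Omega> \<Longrightarrow> cinner z y = 0" for z
      using orthogonal_to_test_fun_eq_zero[OF assms, of z] that by auto
  qed
qed

section \<open>Weak derivatives and the closure of the gradient\<close>

lemma op_app_eq: "single_valued T \<Longrightarrow> (x, y) \<in> T \<Longrightarrow> op_app T x = y"
  unfolding op_app_def by (auto dest: single_valuedD)

lemma weak_partial_iff:
  "(f, g) \<in> weak_partial \<Omega> k \<longleftrightarrow> f \<in> L2_on \<Omega> \<and> g \<in> L2_on \<Omega> \<and>
     (\<forall>\<phi>\<in>test_fun \<Omega>. cinner f (abs_L2 (partial_deriv k \<phi>)) = - cinner g (abs_L2 \<phi>))"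
proof
  assume "(f, g) \<in> weak_partial \<Omega> k"
  then obtain h where "g = - h" "(f, h) \<in> hilbert_adjoint (L2_on \<Omega>) (L2_on \<Omega>) (partial0 \<Omega> k)"
    by (auto simp: weak_partial_def)
  then show "f \<in> L2_on \<Omega> \<and> g \<in> L2_on \<Omega> \<and>
     (\<forall>\<phi>\<in>test_fun \<Omega>. cinner f (abs_L2 (partial_deriv k \<phi>)) = - cinner g (abs_L2 \<phi>))"
    by (auto simp: hilbert_adjoint_def partial0_def cinner_minus_left
        intro: csubspace_minus[OF csubspace_L2_on])
next
  assume "f \<in> L2_on \<Omega> \<and> g \<in> L2_on \<Omega> \<and>
     (\<forall>\<phi>\<in>test_fun \<Omega>. cinner f (abs_L2 (partial_deriv k \<phi>)) = - cinner g (abs_L2 \<phi>))"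
  then have "(f, - g) \<in> hilbert_adjoint (L2_on \<Omega>) (L2_on \<Omega>) (partial0 \<Omega> k)"
    by (auto simp: hilbert_adjoint_def partial0_def cinner_minus_left
        intro: csubspace_minus[OF csubspace_L2_on])
  then show "(f, g) \<in> weak_partial \<Omega> k" unfolding weak_partial_def by force
qed

lemma single_valued_weak_partial:
  assumes "open \<Omega>"
  shows "single_valued (weak_partial \<Omega> k)"
proof (rule single_valuedI)
  fix f g h assume "(f, g) \<in> weak_partial \<Omega> k" "(f, h) \<in> weak_partial \<Omega> k"
  then have "g \<in> L2_on \<Omega>" "h \<in> L2_on \<Omega>" "\<forall>\<phi>\<in>test_fun \<Omega>. cinner (g - h) (abs_L2 \<phi>) = 0"
    by (auto simp: weak_partial_iff cinner_diff_left)
  then have "g - h = 0"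
    by (intro orthogonal_to_test_fun_eq_zero[OF assms] csubspace_diff[OF csubspace_L2_on]) auto
  then show "g = h" by simp
qed

lemma weak_partial_test_fun:
  assumes "f \<in> test_fun \<Omega>"
  shows "(abs_L2 f, abs_L2 (partial_deriv k f)) \<in> weak_partial \<Omega> k"
  using assms by (auto simp: weak_partial_iff integration_by_parts_test_fun
      intro: abs_L2_test_fun_in_L2_on test_fun_partial_deriv)

lemma weak_partial_diff:
  "(f, g) \<in> weak_partial \<Omega> k \<Longrightarrow> (f', g') \<in> weak_partial \<Omega> k \<Longrightarrow> (f - f', g - g') \<in> weak_partial \<Omega> k"
  by (auto simp: weak_partial_iff cinner_diff_left intro: csubspace_diff[OF csubspace_L2_on])

lemma nabla_w_eqI:
  assumes "open \<Omega>" "\<And>k. (u, w $ k) \<in> weak_partial \<Omega> k"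
  shows "nabla_w \<Omega> u = w"
  using op_app_eq[OF single_valued_weak_partial[OF assms(1)] assms(2)]
  by (simp add: nabla_w_def vec_eq_iff)

lemma weak_partial_nabla_w:
  assumes "open \<Omega>" "u \<in> W1 \<Omega>"
  shows "(u, nabla_w \<Omega> u $ k) \<in> weak_partial \<Omega> k"
proof -
  obtain g where g: "(u, g) \<in> weak_partial \<Omega> k" using assms(2) by (auto simp: W1_def)
  then show ?thesis
    using op_app_eq[OF single_valued_weak_partial[OF assms(1)] g] by (simp add: nabla_w_def)
qed

lemma W1_norm_eq: "W1_norm \<Omega> f = norm (f, nabla_w \<Omega> f)"
  by (simp add: W1_norm_def norm_prod_def norm_vec_def L2_set_def nabla_w_def sum_nonneg)

lemma cinner_axis: "cinner (axis k f) w = cinner f (w $ k)"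
proof -
  have "cinner (axis k f) w = (\<Sum>i\<in>UNIV. if i = k then cinner f (w $ i) else 0)"
    unfolding cinner_vec_def by (intro sum.cong) (auto simp: axis_def)
  then show ?thesis by simp
qed

text \<open>
  Fields with one non-zero component, a test function, are in the domain of the adjoint of the
  gradient. These fields suffice to detect the weak derivatives of \<open>u\<close> and to separate the points
  of the space of square-integrable fields.
\<close>

lemma axis_test_fun_in_nabla0_adj:
  assumes "f \<in> test_fun \<Omega>"
  shows "(axis k (abs_L2 f), - abs_L2 (partial_deriv k f)) \<in> nabla0_adj \<Omega>"
  unfolding nabla0_adj_def hilbert_adjoint_def
proof (clarify, intro conjI ballI)
  show "axis k (abs_L2 f) \<in> L2_vec_on \<Omega>"
    using abs_L2_test_fun_in_L2_on[OF assms] csubspace_0[OF csubspace_L2_on, of \<Omega>]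
    by (simp add: L2_vec_on_def axis_def)
  show "- abs_L2 (partial_deriv k f) \<in> L2_on \<Omega>"
    using csubspace_minus[OF csubspace_L2_on abs_L2_test_fun_in_L2_on[OF test_fun_partial_deriv[OF assms]]] .
  fix t assume "t \<in> nabla0 \<Omega>"
  then show "case t of (x, w) \<Rightarrow> cinner (axis k (abs_L2 f)) w = cinner (- abs_L2 (partial_deriv k f)) x"
    using integration_by_parts_test_fun[OF assms]
    by (auto simp: nabla0_def cinner_axis cinner_minus_left)
qed

lemma nabla0_linear_operator:
  assumes "open \<Omega>"
  shows "linear_operator (L2_on \<Omega>) (L2_vec_on \<Omega>) (nabla0 \<Omega>)"
  unfolding linear_operator_def
proof (intro conjI)
  note si = square_integrable_test_fun square_integrable_test_fun[OF test_fun_partial_deriv]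
  show "nabla0 \<Omega> \<subseteq> L2_on \<Omega> \<times> L2_vec_on \<Omega>"
    by (auto simp: nabla0_def L2_vec_on_def abs_L2_test_fun_in_L2_on
        abs_L2_test_fun_in_L2_on[OF test_fun_partial_deriv])
  show "single_valued (nabla0 \<Omega>)"
  proof (rule single_valuedI)
    fix u w w' assume "(u, w) \<in> nabla0 \<Omega>" "(u, w') \<in> nabla0 \<Omega>"
    then have "(u, w $ k) \<in> weak_partial \<Omega> k" "(u, w' $ k) \<in> weak_partial \<Omega> k" for k
      using weak_partial_test_fun by (fastforce simp: nabla0_def)+
    then show "w = w'" using nabla_w_eqI[OF assms] by metis
  qed
  have "(abs_L2 (\<lambda>x. 0), \<chi> k. abs_L2 (partial_deriv k (\<lambda>x. 0))) \<in> nabla0 \<Omega>"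
    unfolding nabla0_def using test_fun_zero by blast
  then show "(0, 0) \<in> nabla0 \<Omega>"
    by (simp add: partial_deriv_const zero_abs_L2[symmetric] zero_vec_def)
  show "\<forall>(x, y)\<in>nabla0 \<Omega>. \<forall>(x', y')\<in>nabla0 \<Omega>. (x + x', y + y') \<in> nabla0 \<Omega>"
  proof clarify
    fix x y x' y' assume "(x, y) \<in> nabla0 \<Omega>" "(x', y') \<in> nabla0 \<Omega>"
    then obtain f g where f: "f \<in> test_fun \<Omega>" "x = abs_L2 f" "y = (\<chi> k. abs_L2 (partial_deriv k f))"
      and g: "g \<in> test_fun \<Omega>" "x' = abs_L2 g" "y' = (\<chi> k. abs_L2 (partial_deriv k g))"
      by (auto simp: nabla0_def)
    have "x + x' = abs_L2 (\<lambda>x. f x + g x)" using f g by (simp add: add_abs_L2 si)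
    moreover have "y + y' = (\<chi> k. abs_L2 (partial_deriv k (\<lambda>x. f x + g x)))"
      using f g by (simp add: vec_eq_iff add_abs_L2 si partial_deriv_add_test_fun)
    ultimately show "(x + x', y + y') \<in> nabla0 \<Omega>"
      unfolding nabla0_def using test_fun_add[OF f(1) g(1)] by blast
  qed
  show "\<forall>a. \<forall>(x, y)\<in>nabla0 \<Omega>. (a *\<^sub>C x, a *\<^sub>C y) \<in> nabla0 \<Omega>"
  proof clarify
    fix a x y assume "(x, y) \<in> nabla0 \<Omega>"
    then obtain f where f: "f \<in> test_fun \<Omega>" "x = abs_L2 f" "y = (\<chi> k. abs_L2 (partial_deriv k f))"
      by (auto simp: nabla0_def)
    have "a *\<^sub>C x = abs_L2 (\<lambda>x. a * f x)" using f by (simp add: scaleC_abs_L2 si)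
    moreover have "a *\<^sub>C y = (\<chi> k. abs_L2 (partial_deriv k (\<lambda>x. a * f x)))"
      using f by (simp add: vec_eq_iff scaleC_vec_def scaleC_abs_L2 si partial_deriv_scale_test_fun)
    ultimately show "(a *\<^sub>C x, a *\<^sub>C y) \<in> nabla0 \<Omega>"
      unfolding nabla0_def using test_fun_scale[OF f(1)] by blast
  qed
qed

lemma nabla0_densely_defined:
  assumes "open \<Omega>"
  shows "densely_defined (L2_on \<Omega>) (nabla0 \<Omega>)"
proof -
  have "Domain (nabla0 \<Omega>) = abs_L2 ` test_fun \<Omega>" by (auto simp: nabla0_def)
  then show ?thesis
    using test_fun_dense[OF assms] by (auto simp: densely_defined_def intro: abs_L2_test_fun_in_L2_on)
qed

lemma nabla0_adj_densely_defined:
  assumes "open (\<Omega> :: (real^'n) set)"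
  shows "densely_defined (L2_vec_on \<Omega>) (nabla0_adj \<Omega>)"
  unfolding densely_defined_def
proof (intro conjI subsetI)
  have cs: "csubspace (nabla0_adj \<Omega>)"
    unfolding nabla0_adj_def by (intro csubspace_hilbert_adjoint csubspace_L2_on csubspace_L2_vec_on)
  have dom: "csubspace (Domain (nabla0_adj \<Omega>))"
    unfolding csubspace_def
  proof (intro conjI ballI allI)
    show "0 \<in> Domain (nabla0_adj \<Omega>)" using csubspace_0[OF cs] by (auto simp: zero_prod_def)
    fix x y assume "x \<in> Domain (nabla0_adj \<Omega>)" "y \<in> Domain (nabla0_adj \<Omega>)"
    then show "x + y \<in> Domain (nabla0_adj \<Omega>)" using csubspace_add[OF cs] by fastforce
    show "a *\<^sub>C x \<in> Domain (nabla0_adj \<Omega>)" for a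
      using csubspace_scaleC[OF cs] \<open>x \<in> _\<close> by (fastforce simp: scaleC_prod_def)
  qed
  have sub: "Domain (nabla0_adj \<Omega>) \<subseteq> L2_vec_on \<Omega>" by (auto simp: nabla0_adj_def hilbert_adjoint_def)
  then show "q \<in> L2_vec_on \<Omega>" if "q \<in> Domain (nabla0_adj \<Omega>)" for q using that by blast
  fix q :: "(real^'n) L2 ^ 'n" assume q: "q \<in> L2_vec_on \<Omega>"
  show "q \<in> closure (Domain (nabla0_adj \<Omega>))"
  proof (rule in_closure_if_orthogonal_to_complement[OF csubspace_L2_vec_on _ dom sub q])
    show "closed (L2_vec_on \<Omega>)" using assms by (intro closed_L2_vec_on) auto
    fix z assume z: "z \<in> L2_vec_on \<Omega>" "\<And>y. y \<in> Domain (nabla0_adj \<Omega>) \<Longrightarrow> cinner z y = 0"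
    have "z $ k = 0" for k
    proof (rule orthogonal_to_test_fun_eq_zero[OF assms])
      show "z $ k \<in> L2_on \<Omega>" using z(1) by (simp add: L2_vec_on_def)
      fix \<phi> assume "\<phi> \<in> test_fun \<Omega>"
      then have "cinner z (axis k (abs_L2 \<phi>)) = 0"
        by (intro z(2) DomainI[OF axis_test_fun_in_nabla0_adj])
      then have "cinner (axis k (abs_L2 \<phi>)) z = 0"
        using cinner_commute[of "axis k (abs_L2 \<phi>)" z] by simp
      then show "cinner (z $ k) (abs_L2 \<phi>) = 0"
        using cinner_commute[of "z $ k" "abs_L2 \<phi>"] by (simp add: cinner_axis)
    qed
    then have "z = 0" by (simp add: vec_eq_iff)
    then show "cinner z q = 0" by simp
  qed
qed

text \<open>
  The Sobolev norm is the graph norm of the weak gradient, and the weak gradient extends the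
  classical one. So the two descriptions differ only in that a limit of classical gradients has to
  be recognized as a weak gradient; this is done by pairing with the fields \<open>axis k \<phi>\<close>.
\<close>

lemma closure_nabla0_iff:
  assumes "open \<Omega>"
  shows "(u, w) \<in> closure (nabla0 \<Omega>) \<longleftrightarrow> u \<in> W1_0 \<Omega> \<and> w = nabla_w \<Omega> u"
proof -
  have approx: "W1_norm \<Omega> (u - abs_L2 \<phi>)
      = dist (u, nabla_w \<Omega> u) (abs_L2 \<phi>, \<chi> k. abs_L2 (partial_deriv k \<phi>))"
    if "u \<in> W1 \<Omega>" "\<phi> \<in> test_fun \<Omega>" for \<phi>
  proof -
    let ?g = "\<chi> k. abs_L2 (partial_deriv k \<phi>)"
    have "nabla_w \<Omega> (u - abs_L2 \<phi>) = nabla_w \<Omega> u - ?g"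
      using weak_partial_diff[OF weak_partial_nabla_w[OF assms that(1)] weak_partial_test_fun[OF that(2)]]
      by (intro nabla_w_eqI assms) simp
    then show ?thesis by (simp add: W1_norm_eq dist_norm)
  qed
  have W1: "u \<in> W1 \<Omega> \<and> w = nabla_w \<Omega> u" if uw: "(u, w) \<in> closure (nabla0 \<Omega>)"
  proof -
    have "closure (nabla0 \<Omega>) \<subseteq> L2_on \<Omega> \<times> L2_vec_on \<Omega>"
      using nabla0_linear_operator[OF assms] assms
      by (intro closure_minimal closed_Times closed_L2_on closed_L2_vec_on)
        (auto simp: linear_operator_def)
    then have mem: "u \<in> L2_on \<Omega>" "\<And>k. w $ k \<in> L2_on \<Omega>" using uw by (auto simp: L2_vec_on_def)
    have "cinner u (abs_L2 (partial_deriv k \<phi>)) = - cinner (w $ k) (abs_L2 \<phi>)"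
      if "\<phi> \<in> test_fun \<Omega>" for \<phi> k
    proof -
      have "cinner (axis k (abs_L2 \<phi>)) w = cinner (- abs_L2 (partial_deriv k \<phi>)) u"
        using axis_test_fun_in_nabla0_adj[OF that] uw
        unfolding nabla0_adj_def by (rule hilbert_adjoint_closure)
      then show ?thesis
        using cinner_commute[of u "abs_L2 (partial_deriv k \<phi>)"] cinner_commute[of "w $ k" "abs_L2 \<phi>"]
        by (simp add: cinner_axis cinner_minus_left)
    qed
    then have wp: "(u, w $ k) \<in> weak_partial \<Omega> k" for k using mem by (simp add: weak_partial_iff)
    then show ?thesis using nabla_w_eqI[OF assms wp] by (auto simp: W1_def)
  qed
  have "(u, nabla_w \<Omega> u) \<in> closure (nabla0 \<Omega>) \<longleftrightarrow>
      (\<forall>\<epsilon>>0. \<exists>\<phi>\<in>test_fun \<Omega>. W1_norm \<Omega> (u - abs_L2 \<phi>) < \<epsilon>)" if "u \<in> W1 \<Omega>"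
    unfolding closure_approachable dist_commute[of _ "(u, nabla_w \<Omega> u)"] nabla0_def
    using approx[OF that] by fastforce
  then show ?thesis using W1 by (auto simp: W1_0_def)
qed

section \<open>Self-adjointness of the block operator\<close>

theorem theorem5p0p2:
  fixes \<Omega> :: "(real^'n) set" and p :: "real^'n \<Rightarrow> real"
  assumes "open \<Omega>" and "\<Omega> \<noteq> {}"
    and "\<exists>j. \<exists>c>0. \<forall>f\<in>W1_0 \<Omega>. norm (op_app (weak_partial \<Omega> j) f) \<ge> c * norm f"
    and "p \<in> Linfty_on \<Omega>"
  shows "self_adjoint (L2_on \<Omega> \<times> L2_vec_on \<Omega>) (A_hat \<Omega> p)"
proof -
  have \<Omega>: "\<Omega> \<in> sets lebesgue" using assms(1) by auto
  let ?P = "\<lambda>q :: (real^'n) L2 ^ 'n. \<chi> k. mult_on \<Omega> p (q $ k)"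
  have sv: "single_valued (nabla0_adj \<Omega>)"
    unfolding nabla0_adj_def
    by (intro single_valued_hilbert_adjoint csubspace_L2_on nabla0_densely_defined assms(1))
  have A: "A_hat \<Omega> p = {((u, q), (z, w - ?P q)) | u q z w.
      (u, w) \<in> closure (nabla0 \<Omega>) \<and> (q, z) \<in> nabla0_adj \<Omega>}"
    unfolding A_hat_def closure_nabla0_iff[OF assms(1)]
    by (auto simp: op_app_eq[OF sv])
  show ?thesis
  proof (rule self_adjoint_block_operator[where P = ?P and T = "nabla0 \<Omega>"])
    show "A_hat \<Omega> p = {((u, q), (z, w - ?P q)) | u q z w. (u, w) \<in> closure (nabla0 \<Omega>) \<and>
        (q, z) \<in> hilbert_adjoint (L2_on \<Omega>) (L2_vec_on \<Omega>) (nabla0 \<Omega>)}"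
      using A unfolding nabla0_adj_def .
    show "densely_defined (L2_vec_on \<Omega>) (hilbert_adjoint (L2_on \<Omega>) (L2_vec_on \<Omega>) (nabla0 \<Omega>))"
      using nabla0_adj_densely_defined[OF assms(1)] unfolding nabla0_adj_def .
    show "?P q \<in> L2_vec_on \<Omega>" for q
      using mult_on_in_L2_on[OF \<Omega> assms(4)] by (simp add: L2_vec_on_def)
    show "?P (q + r) = ?P q + ?P r" for q r
      by (simp add: vec_eq_iff mult_on_add[OF \<Omega> assms(4)])
    show "?P (a *\<^sub>C q) = a *\<^sub>C ?P q" for a q
      by (simp add: vec_eq_iff scaleC_vec_def mult_on_scaleC[OF \<Omega> assms(4)])
    show "cinner (?P q) r = cinner q (?P r)" for q r
      by (simp add: cinner_vec_def mult_on_symmetric[OF \<Omega> assms(4)])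
  qed (intro csubspace_L2_on csubspace_L2_vec_on closed_L2_on closed_L2_vec_on \<Omega>
      nabla0_linear_operator nabla0_densely_defined assms(1))+
qed

end
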